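(* Let $A,B$ be complex $3\times 3$ matrices. The following are equivalent: (1) $A$ and $B$ have identical pseudospectra, i.e. $\|(zI-A)^{-1}\|=\|(zI-B)^{-1}\|$ for all $z\in\mathbb{C}$; (2) $A$ and $B$ are polynomially isometric, i.e. $\|p(A)\|=\|p(B)\|$ for every complex polynomial $p$. Moreover, if $A$ and $B$ also have the same minimal polynomial and it has degree $2$, then (1) and (2) are equivalent to (3) $\|A-\gamma_AI\|_F=\|B-\gamma_BI\|_F$, where $\gamma_A$ and $\gamma_B$ are the eigenvalues of $A$ and of $B$, respectively, of largest multiplicity.
   Context: $\|\cdot\|$ is the spectral norm and $\|T\|_F=\sqrt{\operatorname{tr}T^*T}$ the Frobenius norm. By convention $\|(zI-T)^{-1}\|=\infty$ for $z$ an eigenvalue of $T$. *)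

theory Defs
  imports "HOL-Analysis.Analysis" "HOL-Computational_Algebra.Polynomial" "HOL-Library.Extended_Real"
begin

type_synonym cmat3 = "complex^3^3"

definition spec_norm :: "cmat3 \<Rightarrow> real" where
  "spec_norm T = onorm (\<lambda>x. T *v x)"

definition frob_norm :: "cmat3 \<Rightarrow> real" where
  "frob_norm T = sqrt (\<Sum>i\<in>UNIV. \<Sum>j\<in>UNIV. (cmod (T $ i $ j))\<^sup>2)"

definition res_norm :: "cmat3 \<Rightarrow> complex \<Rightarrow> ereal" where
  "res_norm T z = (if det (mat z - T) = 0 then \<infinity>
      else ereal (spec_norm (matrix_inv (mat z - T))))"

fun mat_pow :: "cmat3 \<Rightarrow> nat \<Rightarrow> cmat3" where
  "mat_pow T 0 = mat 1"
| "mat_pow T (Suc n) = T ** mat_pow T n"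

definition poly_mat :: "complex poly \<Rightarrow> cmat3 \<Rightarrow> cmat3" where
  "poly_mat p T = (\<Sum>i\<le>degree p. mat (coeff p i) ** mat_pow T i)"

definition is_min_poly :: "cmat3 \<Rightarrow> complex poly \<Rightarrow> bool" where
  "is_min_poly T p \<longleftrightarrow> lead_coeff p = 1 \<and> poly_mat p T = 0 \<and>
     (\<forall>q. q \<noteq> 0 \<and> poly_mat q T = 0 \<longrightarrow> degree p \<le> degree q)"

definition charpoly :: "cmat3 \<Rightarrow> complex poly" where
  "charpoly T = det (\<chi> i j. (if i = j then [:0, 1:] else 0) - [:T $ i $ j:])"

definition max_mult_eig :: "cmat3 \<Rightarrow> complex \<Rightarrow> bool" where
  "max_mult_eig T \<gamma> \<longleftrightarrow> poly (charpoly T) \<gamma> = 0 \<and>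
     (\<forall>\<mu>. order \<mu> (charpoly T) \<le> order \<gamma> (charpoly T))"

end

theory Submission
  imports Defs "HOL-Computational_Algebra.Fundamental_Theorem_Algebra"
begin

text \<open>
  The squared spectral norm of a \<open>3 \<times> 3\<close> matrix \<open>T\<close> is the largest root of
  \<open>x\<^sup>3 - \<parallel>T\<parallel>\<^sub>F\<^sup>2 x\<^sup>2 + \<parallel>adj T\<parallel>\<^sub>F\<^sup>2 x - |det T|\<^sup>2\<close>, the characteristic polynomial of \<open>T\<^sup>*T\<close>.

  Suppose the pseudospectra agree and the characteristic polynomials agree. Subtracting the
  equations for \<open>T = adj (z - A)\<close> and \<open>T = adj (z - B)\<close> gives \<open>d\<^sub>2(z) = d\<^sub>1 \<mu>(z)\<close>, where
  \<open>\<mu>(z)\<close> is the squared least singular value of \<open>z - A\<close>, \<open>d\<^sub>1 = \<parallel>A\<parallel>\<^sub>F\<^sup>2 - \<parallel>B\<parallel>\<^sub>F\<^sup>2\<close> is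
  constant and \<open>d\<^sub>2(z) = d\<^sub>1|z|\<^sup>2 + 2 Re (zh) + k\<close>. If \<open>d\<^sub>1 \<noteq> 0\<close>, then
  \<open>0 \<le> \<mu>(z) \<le> |z - a|\<^sup>2\<close> for an eigenvalue \<open>a\<close> forces \<open>\<mu>(z) = |z - a|\<^sup>2\<close>, so that both
  matrices equal \<open>a I\<close>, which is absurd. Hence \<open>d\<^sub>1 = h = k = 0\<close>, which says that
  \<open>I\<close>, \<open>A - tr A\<close>, \<open>adj A\<close> and the corresponding matrices for \<open>B\<close> have the same Frobenius
  Gram matrix. These three matrices span the polynomials in \<open>A\<close>, and the adjugate and
  determinant of \<open>p(A)\<close> are again computed from polynomials in \<open>A\<close> and traces, so all
  \<open>\<parallel>p(A)\<parallel>\<close> agree.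

  If the characteristic polynomials differ, they are \<open>(z - a)\<^sup>2(z - b)\<close> and
  \<open>(z - b)\<^sup>2(z - a)\<close>, and comparing the growth of the resolvents at \<open>a\<close> and at \<open>b\<close> shows that
  \<open>A - a\<close> and \<open>B - b\<close> have rank one. For rank one perturbations of scalars, as for matrices with
  quadratic minimal polynomial, all norms are explicit functions of the eigenvalues and the
  Frobenius norm, and the latter can be read off from a single resolvent norm.
\<close>

section \<open>The adjugate and the Frobenius inner product\<close>

lemmas mat3_simps = vec_eq_iff forall_3 matrix_matrix_mult_def sum_3 trace_def det_3 mat_def

text \<open>The second elementary symmetric function of the eigenvalues, written through traces so
  that it carries over to polynomials in \<open>T\<close>.\<close>

definition e2 :: "cmat3 \<Rightarrow> complex" where
  "e2 T = ((trace T)\<^sup>2 - trace (T ** T)) / 2"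

text \<open>The classical adjugate. Written in this form it is visibly a polynomial in \<open>T\<close>.\<close>

definition adj3 :: "cmat3 \<Rightarrow> cmat3" where
  "adj3 T = T ** T - mat (trace T) ** T + mat (e2 T)"

text \<open>The Frobenius inner product, kept complex so that norm computations become ring
  identities.\<close>

definition cip :: "cmat3 \<Rightarrow> cmat3 \<Rightarrow> complex" where
  "cip S T = (\<Sum>i\<in>UNIV. \<Sum>j\<in>UNIV. S $ i $ j * cnj (T $ i $ j))"

definition cadj :: "cmat3 \<Rightarrow> cmat3" where
  "cadj T = (\<chi> i j. cnj (T $ j $ i))"

lemma e2_minors:
  "e2 T = T$1$1 * T$2$2 - T$1$2 * T$2$1 + T$1$1 * T$3$3 - T$1$3 * T$3$1 + T$2$2 * T$3$3 - T$2$3 * T$3$2"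
  by (simp add: e2_def mat3_simps power2_eq_square field_simps)

lemma adj3_minors:
  "adj3 T $ 1 $ 1 = T$2$2 * T$3$3 - T$2$3 * T$3$2"
  "adj3 T $ 1 $ 2 = T$1$3 * T$3$2 - T$1$2 * T$3$3"
  "adj3 T $ 1 $ 3 = T$1$2 * T$2$3 - T$1$3 * T$2$2"
  "adj3 T $ 2 $ 1 = T$2$3 * T$3$1 - T$2$1 * T$3$3"
  "adj3 T $ 2 $ 2 = T$1$1 * T$3$3 - T$1$3 * T$3$1"
  "adj3 T $ 2 $ 3 = T$1$3 * T$2$1 - T$1$1 * T$2$3"
  "adj3 T $ 3 $ 1 = T$2$1 * T$3$2 - T$2$2 * T$3$1"
  "adj3 T $ 3 $ 2 = T$1$2 * T$3$1 - T$1$1 * T$3$2"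
  "adj3 T $ 3 $ 3 = T$1$1 * T$2$2 - T$1$2 * T$2$1"
  by (simp_all add: adj3_def e2_minors mat3_simps algebra_simps)

lemma mult_adj3: "T ** adj3 T = mat (det T)"
  by (simp add: adj3_minors mat3_simps algebra_simps)

lemma adj3_mult: "adj3 T ** T = mat (det T)"
  by (simp add: adj3_minors mat3_simps algebra_simps)

lemma adj3_adj3: "adj3 (adj3 T) = mat (det T) ** T"
  by (simp add: adj3_minors mat3_simps algebra_simps)

lemma det_adj3: "det (adj3 T) = (det T)\<^sup>2"
  by (simp add: adj3_minors det_3 power2_eq_square algebra_simps)

lemma trace_adj3: "trace (adj3 T) = e2 T"
  by (simp add: adj3_minors e2_minors mat3_simps algebra_simps)

lemma det_mat_plus_scaled:
  "det (mat \<alpha> + mat \<beta> ** E :: cmat3)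
   = \<alpha>^3 + \<alpha>\<^sup>2 * \<beta> * trace E + \<alpha> * \<beta>\<^sup>2 * e2 E + \<beta>^3 * det E"
  by (simp add: e2_minors mat3_simps power2_eq_square power3_eq_cube algebra_simps)

lemma adj3_mat_plus_scaled:
  "adj3 (mat \<alpha> + mat \<beta> ** E)
   = mat (\<alpha>\<^sup>2) + mat (\<alpha> * \<beta>) ** (mat (trace E) - E) + mat (\<beta>\<^sup>2) ** adj3 E"
  by (simp add: adj3_minors mat3_simps power2_eq_square algebra_simps)

lemma mat_minus_eq: "mat z - T = mat z + mat (-1) ** (T :: cmat3)"
  by (simp add: mat3_simps)

lemma det_mat_minus:
  "det (mat z - T :: cmat3) = z^3 - trace T * z\<^sup>2 + e2 T * z - det T"
  unfolding mat_minus_eq det_mat_plus_scaled by (simp add: algebra_simps)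

lemma adj3_mat_minus:
  "adj3 (mat z - T) = mat (z\<^sup>2) + mat z ** (T - mat (trace T)) + adj3 T"
  unfolding mat_minus_eq adj3_mat_plus_scaled by (simp add: mat3_simps algebra_simps)

lemma mat_mult_component: "(mat c ** T) $ i $ j = c * (T :: cmat3) $ i $ j"
proof -
  have "\<forall>i j. (mat c ** T) $ i $ j = c * T $ i $ j" by (simp add: mat3_simps)
  then show ?thesis by blast
qed

lemma mat_mult_commute: "T ** mat c = mat c ** (T :: cmat3)"
  by (simp add: mat3_simps)

lemma cip_add_left: "cip (S + S') T = cip S T + cip S' T"
  by (simp add: cip_def sum.distrib algebra_simps)
lemma cip_add_right: "cip T (S + S') = cip T S + cip T S'"
  by (simp add: cip_def sum.distrib algebra_simps)
lemma cip_diff_left: "cip (S - S') T = cip S T - cip S' T"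
  by (simp add: cip_def sum_subtractf algebra_simps)
lemma cip_diff_right: "cip T (S - S') = cip T S - cip T S'"
  by (simp add: cip_def sum_subtractf algebra_simps)
lemma cip_scale_left: "cip (mat c ** S) T = c * cip S T"
  by (simp add: cip_def mat_mult_component sum_distrib_left mult.assoc)
lemma cip_scale_right: "cip T (mat c ** S) = cnj c * cip T S"
  by (simp add: cip_def mat_mult_component sum_distrib_left mult_ac)
lemma cip_mat_right: "cip T (mat c) = cnj c * trace T"
  by (simp add: cip_def mat3_simps algebra_simps)
lemma cip_mat_left: "cip (mat c) T = c * cnj (trace T)"
  by (simp add: cip_def mat3_simps algebra_simps)
lemma cip_commute: "cip S T = cnj (cip T S)"
  by (simp add: cip_def mult.commute)
lemma trace_mat: "trace (mat c :: cmat3) = 3 * c"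
  by (simp add: mat3_simps)

lemma trace_scale: "trace (mat c ** T) = c * trace (T :: cmat3)"
  by (simp add: mat3_simps algebra_simps)

lemmas cip_simps = cip_add_left cip_add_right cip_diff_left cip_diff_right cip_scale_left cip_scale_right
  cip_mat_left cip_mat_right trace_mat trace_add trace_sub trace_scale

lemma cip_self: "cip T T = of_real ((frob_norm T)\<^sup>2)"
  by (simp add: cip_def frob_norm_def sum_nonneg complex_norm_square del: of_real_power)

lemma frob_norm_nonneg: "frob_norm T \<ge> 0"
  by (simp add: frob_norm_def sum_nonneg)

lemma frob_norm_eqI: "cip S S = cip T T \<Longrightarrow> frob_norm S = frob_norm T"
  using frob_norm_nonneg[of S] frob_norm_nonneg[of T]
  unfolding cip_self of_real_eq_iff by (simp add: power2_eq_iff_nonneg)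

text \<open>By Cauchy-Binet, \<open>e2 (cadj T ** T)\<close> is the sum of the squared moduli of the
  2 by 2 minors of \<open>T\<close>.\<close>

lemma det_char_gram:
  "det (mat x - cadj T ** T)
   = x^3 - cip T T * x\<^sup>2 + cip (adj3 T) (adj3 T) * x - det T * cnj (det T)"
proof -
  have 1: "trace (cadj T ** T) = cip T T"
    by (simp add: cadj_def cip_def mat3_simps algebra_simps)
  have 2: "e2 (cadj T ** T) = cip (adj3 T) (adj3 T)"
    by (simp add: cadj_def cip_def e2_minors adj3_minors matrix_matrix_mult_def sum_3 algebra_simps)
  have 3: "det (cadj T) = cnj (det T)"
    by (simp add: cadj_def det_3 algebra_simps)
  show ?thesis unfolding det_mat_minus 1 2 det_mul 3 by (simp add: mult.commute)
qed

section \<open>The spectral norm as a root of a cubic\<close>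

lemma inner_matrix_vector: "(T *v x) \<bullet> y = x \<bullet> (cadj T *v y)"
  for T :: cmat3
  by (simp add: inner_vec_def inner_complex_def matrix_vector_mult_def sum_3 cadj_def algebra_simps)

lemma norm_mult_vec_le: "norm (T *v x) \<le> spec_norm T * norm x"
  unfolding spec_norm_def by (rule onorm) simp

lemma spec_norm_nonneg: "spec_norm T \<ge> 0"
  unfolding spec_norm_def by (rule onorm_pos_le) simp

lemma mat_mult_vec: "mat c *v x = c *s (x :: complex^3)"
  by (simp add: vec_eq_iff forall_3 matrix_vector_mult_def sum_3 mat_def)

lemma norm_scale_vec: "norm (c *s (x :: complex^3)) = cmod c * norm x"
  by (simp add: norm_vec_def norm_mult L2_set_right_distrib)

text \<open>Cauchy-Schwarz for \<open>T *v (cadj T *v w)\<close> and \<open>w\<close>, after which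
  one factor \<open>norm (cadj T *v w)\<close> cancels.\<close>

lemma norm_cadj_le: "norm (cadj T *v w) \<le> spec_norm T * norm w"
proof -
  have "(norm (cadj T *v w))\<^sup>2 = (T *v (cadj T *v w)) \<bullet> w"
    by (simp add: power2_norm_eq_inner inner_matrix_vector)
  also have "\<dots> \<le> norm (T *v (cadj T *v w)) * norm w" by (rule norm_cauchy_schwarz)
  also have "\<dots> \<le> spec_norm T * norm (cadj T *v w) * norm w"
    by (intro mult_right_mono norm_mult_vec_le) simp
  finally have "norm (cadj T *v w) * norm (cadj T *v w) \<le> norm (cadj T *v w) * (spec_norm T * norm w)"
    by (simp add: power2_eq_square mult_ac)
  then show ?thesis
    using spec_norm_nonneg[of T] by (cases "norm (cadj T *v w) = 0") auto
qed

lemma spec_norm_attained: "\<exists>v. norm v = 1 \<and> norm (T *v v) = spec_norm T"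
proof -
  have "\<exists>x\<in>sphere 0 1. \<forall>y\<in>sphere 0 1. norm (T *v y) \<le> norm (T *v (x :: complex^3))"
  proof (rule continuous_attains_sup)
    have "norm (axis 1 1 :: complex^3) = 1" by simp
    then show "sphere 0 1 \<noteq> ({} :: (complex^3) set)"
      by (metis dist_0_norm empty_iff mem_sphere)
    show "continuous_on (sphere 0 1) (\<lambda>x. norm (T *v x))"
      by (intro continuous_on_norm linear_continuous_on) simp
  qed simp
  then obtain v where v: "norm v = 1" and max: "\<And>y. norm y = 1 \<Longrightarrow> norm (T *v y) \<le> norm (T *v v)"
    by auto
  have "norm (T *v x) \<le> norm (T *v v) * norm x" for x
  proof (cases "x = 0")
    case False
    have "norm (T *v ((1 / norm x) *\<^sub>R x)) \<le> norm (T *v v)"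
      by (rule max) (use False in simp)
    moreover have "T *v ((1 / norm x) *\<^sub>R x) = (1 / norm x) *\<^sub>R (T *v x)"
      by (rule linear_cmul) (simp add: bounded_linear.linear)
    ultimately show ?thesis using False by (simp add: field_simps)
  qed simp
  then have "spec_norm T \<le> norm (T *v v)"
    unfolding spec_norm_def by (intro onorm_bound) auto
  with norm_mult_vec_le[of T v] v show ?thesis by (intro exI[of _ v]) auto
qed

lemma det_eq_0_iff_kernel: "det (S :: cmat3) = 0 \<longleftrightarrow> (\<exists>v. v \<noteq> 0 \<and> S *v v = 0)"
  using invertible_det_nz[of S] invertible_left_inverse[of S] matrix_left_invertible_ker[of S] by blast

lemma det_gram_real:
  "det (mat (of_real x) - cadj T ** T)
   = of_real (x^3 - (frob_norm T)\<^sup>2 * x\<^sup>2 + (frob_norm (adj3 T))\<^sup>2 * x - (cmod (det T))\<^sup>2)"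
  by (simp add: det_char_gram cip_self complex_norm_square[symmetric] del: of_real_power)
     (simp add: complex_norm_square)

text \<open>A unit vector maximising \<open>norm (T *v v)\<close> is an eigenvector of
  \<open>cadj T ** T\<close> for the eigenvalue \<open>X\<close>.\<close>

lemma spec_norm_root:
  fixes T :: cmat3
  defines "X \<equiv> (spec_norm T)\<^sup>2"
  shows "X^3 - (frob_norm T)\<^sup>2 * X\<^sup>2 + (frob_norm (adj3 T))\<^sup>2 * X - (cmod (det T))\<^sup>2 = 0"
proof -
  obtain v where v: "norm v = 1" "norm (T *v v) = spec_norm T" using spec_norm_attained by blast
  define w where "w = cadj T *v (T *v v)"
  have vw: "v \<bullet> w = X"
    by (simp add: w_def X_def inner_matrix_vector[symmetric] power2_norm_eq_inner[symmetric] v)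
  have w: "norm w \<le> X"
    using norm_cadj_le[of T "T *v v"] v by (simp add: w_def X_def power2_eq_square)
  \<comment> \<open>Equality case of Cauchy-Schwarz: \<open>v \<bullet> w = X\<close> and
    \<open>norm w \<le> X\<close> leave at most \<open>X^2 - 2 * X^2 + X^2\<close>.\<close>
  have "(norm (X *\<^sub>R v - w))\<^sup>2 \<le> 0"
  proof -
    have "(norm (X *\<^sub>R v - w))\<^sup>2 = X\<^sup>2 * (norm v)\<^sup>2 - 2 * X * (v \<bullet> w) + (norm w)\<^sup>2"
      unfolding power2_norm_eq_inner by (simp add: inner_diff inner_commute power2_eq_square)
    with vw w show ?thesis using v power_mono[of "norm w" X 2] by (simp add: power2_eq_square)
  qed
  then have "X *\<^sub>R v - w = 0" by simp
  then have "w = X *\<^sub>R v" by simp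
  then have "(mat (of_real X) - cadj T ** T) *v v = 0"
    by (simp add: matrix_vector_mult_diff_rdistrib matrix_vector_mul_assoc[symmetric] w_def[symmetric]
        mat_mult_vec vec_eq_iff scaleR_conv_of_real[where 'a = complex])
  with v have "det (mat (of_real X) - cadj T ** T) = 0"
    unfolding det_eq_0_iff_kernel by (intro exI[of _ v]) auto
  then show ?thesis unfolding det_gram_real of_real_eq_0_iff .
qed

text \<open>A root comes with an eigenvector \<open>v\<close> of \<open>cadj T ** T\<close>, and
  pairing with \<open>v\<close> exhibits \<open>x\<close> as the quotient of the squared norms of
  \<open>T *v v\<close> and \<open>v\<close>.\<close>

lemma spec_norm_greatest_root:
  assumes "x^3 - (frob_norm T)\<^sup>2 * x\<^sup>2 + (frob_norm (adj3 T))\<^sup>2 * x - (cmod (det T))\<^sup>2 = 0"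
  shows "x \<le> (spec_norm T)\<^sup>2"
proof -
  have "det (mat (of_real x) - cadj T ** T) = 0" using assms unfolding det_gram_real by simp
  then obtain v where v: "v \<noteq> 0" "(mat (of_real x) - cadj T ** T) *v v = 0"
    unfolding det_eq_0_iff_kernel by blast
  then have "cadj T *v (T *v v) = x *\<^sub>R v"
    by (simp add: matrix_vector_mult_diff_rdistrib matrix_vector_mul_assoc[symmetric]
        mat_mult_vec vec_eq_iff scaleR_conv_of_real[where 'a = complex])
  then have "x * (norm v)\<^sup>2 = (norm (T *v v))\<^sup>2"
    by (simp add: power2_norm_eq_inner inner_matrix_vector)
  also have "\<dots> \<le> (spec_norm T * norm v)\<^sup>2" by (intro power_mono norm_mult_vec_le) simp
  finally show ?thesis using v by (simp add: power_mult_distrib)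
qed

text \<open>The three numbers are the coefficients of the cubic, so each squared norm is a root of
  the other's cubic.\<close>

lemma spec_norm_eqI:
  assumes "frob_norm S = frob_norm T" "frob_norm (adj3 S) = frob_norm (adj3 T)"
    "cmod (det S) = cmod (det T)"
  shows "spec_norm S = spec_norm T"
proof -
  have "(spec_norm S)\<^sup>2 \<le> (spec_norm T)\<^sup>2"
    by (rule spec_norm_greatest_root) (use spec_norm_root[of S] assms in simp)
  moreover have "(spec_norm T)\<^sup>2 \<le> (spec_norm S)\<^sup>2"
    by (rule spec_norm_greatest_root) (use spec_norm_root[of T] assms in simp)
  ultimately show ?thesis using spec_norm_nonneg[of S] spec_norm_nonneg[of T]
    by (simp add: power2_eq_iff_nonneg)
qed

section \<open>Scaling, entrywise bounds and the resolvent norm\<close>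

lemma spec_norm_scale: "spec_norm (mat c ** T) = cmod c * spec_norm T"
proof -
  have *: "(mat c ** T) *v x = c *s (T *v x)" for x
    by (simp add: matrix_vector_mul_assoc[symmetric] mat_mult_vec)
  obtain v where v: "norm v = 1" "norm (T *v v) = spec_norm T" using spec_norm_attained by blast
  have "cmod c * spec_norm T \<le> spec_norm (mat c ** T)"
    using norm_mult_vec_le[of "mat c ** T" v] v by (simp add: * norm_scale_vec)
  moreover have "spec_norm (mat c ** T) \<le> cmod c * spec_norm T"
    using norm_mult_vec_le[of T] unfolding spec_norm_def[of "mat c ** T"]
    by (intro onorm_bound) (auto simp: * norm_scale_vec spec_norm_nonneg mult.assoc intro: mult_left_mono)
  ultimately show ?thesis by simp
qed

lemma cmod_component_le_spec_norm: "cmod (T $ i $ j) \<le> spec_norm T"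
proof -
  have "(T *v axis j 1) $ i = T $ i $ j" by (simp add: matrix_vector_mult_def axis_def if_distrib cong: if_cong)
  then have "cmod (T $ i $ j) \<le> norm (T *v axis j 1)" by (metis Finite_Cartesian_Product.norm_nth_le)
  also have "\<dots> \<le> spec_norm T" using norm_mult_vec_le[of T "axis j 1"] by simp
  finally show ?thesis .
qed

lemma spec_norm_eq_0_iff: "spec_norm T = 0 \<longleftrightarrow> T = 0"
proof
  assume "spec_norm T = 0"
  then show "T = 0" using cmod_component_le_spec_norm[of T] by (simp add: vec_eq_iff)
qed (simp add: spec_norm_def onorm_zero)

lemma spec_norm_le_sum: "spec_norm T \<le> (\<Sum>i\<in>UNIV. \<Sum>j\<in>UNIV. cmod (T $ i $ j))"
  unfolding spec_norm_def
proof (rule onorm_bound)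
  fix x :: "complex^3"
  have "norm (T *v x) \<le> (\<Sum>i\<in>UNIV. cmod ((T *v x) $ i))"
    unfolding norm_vec_def by (rule L2_set_le_sum) simp
  also have "\<dots> \<le> (\<Sum>i\<in>UNIV. \<Sum>j\<in>UNIV. cmod (T $ i $ j) * norm x)"
    unfolding matrix_vector_mult_def
    by (auto intro!: sum_mono sum_norm_le mult_left_mono Finite_Cartesian_Product.norm_nth_le simp: norm_mult)
  finally show "norm (T *v x) \<le> (\<Sum>i\<in>UNIV. \<Sum>j\<in>UNIV. cmod (T $ i $ j)) * norm x"
    by (simp add: sum_distrib_right)
qed (simp add: sum_nonneg)

text \<open>Resolvent identities are available only off the finite spectrum; a finite set has dense
  complement, so continuity carries inequalities to the eigenvalues.\<close>

lemma le_off_finite: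
  fixes f g :: "complex \<Rightarrow> real"
  assumes "continuous_on UNIV f" "continuous_on UNIV g" "finite F" "\<And>z. z \<notin> F \<Longrightarrow> f z \<le> g z"
  shows "f z \<le> g z"
proof -
  have "closed {z. f z \<le> g z}" using assms(1,2) by (rule closed_Collect_le)
  moreover have "- F \<subseteq> {z. f z \<le> g z}" using assms(4) by auto
  ultimately have "closure (- F) \<subseteq> {z. f z \<le> g z}" by (rule closure_minimal[rotated])
  moreover have "interior F = {}" using finite_imp_not_open[of "interior F"] finite_subset[OF interior_subset assms(3)] by auto
  ultimately show ?thesis by (auto simp: closure_complement)
qed

lemma matrix_inv_eqI: "S ** X = mat 1 \<Longrightarrow> matrix_inv S = (X :: cmat3)"
proof -
  assume X: "S ** X = mat 1"
  then have "X ** S = mat 1" by (rule matrix_left_right_inverse1)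
  with X have "\<exists>Y. S ** Y = mat 1 \<and> Y ** S = mat 1" by blast
  then have "matrix_inv S ** S = mat 1" unfolding matrix_inv_def by (rule someI2_ex) blast
  then show ?thesis by (metis X matrix_mul_assoc matrix_mul_lid matrix_mul_rid)
qed

text \<open>Cramer's rule turns resolvents into adjugates, whose entries are polynomial in
  \<open>z\<close>.\<close>

lemma res_norm_adj3:
  "det (mat z - T) \<noteq> 0 \<Longrightarrow> res_norm T z = ereal (spec_norm (adj3 (mat z - T)) / cmod (det (mat z - T)))"
proof -
  let ?S = "mat z - T"
  assume d: "det ?S \<noteq> 0"
  have "?S ** (mat (inverse (det ?S)) ** adj3 ?S) = mat (inverse (det ?S)) ** (?S ** adj3 ?S)"
    by (simp add: matrix_mul_assoc mat_mult_commute)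
  also have "\<dots> = mat 1" unfolding mult_adj3 using d by (simp add: mat3_simps)
  finally have "matrix_inv ?S = mat (inverse (det ?S)) ** adj3 ?S" by (rule matrix_inv_eqI)
  then show ?thesis using d by (simp add: res_norm_def spec_norm_scale norm_inverse divide_inverse mult.commute)
qed

section \<open>Polynomials in a matrix\<close>

lemma matrix_add_mult_distrib: "(S + S') ** T = S ** T + S' ** (T :: cmat3)"
  by (simp add: mat3_simps algebra_simps)

lemma matrix_mult_sum_right: "(T :: cmat3) ** (\<Sum>i\<in>S. f i) = (\<Sum>i\<in>S. T ** f i)"
  by (induction S rule: infinite_finite_induct) (auto simp: matrix_add_ldistrib)

lemma poly_mat_0: "poly_mat 0 T = 0"
  by (simp add: poly_mat_def mat3_simps)

lemma poly_mat_pCons: "poly_mat (pCons c p) T = mat c + T ** poly_mat p T"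
proof (cases "p = 0")
  case True
  then show ?thesis by (simp add: poly_mat_def mat3_simps)
next
  case False
  have "mat k ** (T ** S) = T ** (mat k ** S)" for k and S :: cmat3
    by (simp add: matrix_mul_assoc mat_mult_commute)
  with False show ?thesis
    by (simp add: poly_mat_def sum.atMost_Suc_shift matrix_mult_sum_right del: sum.atMost_Suc)
qed

lemma poly_mat_add: "poly_mat (p + q) T = poly_mat p T + poly_mat q T"
proof (induction p q rule: poly_induct2)
  case (pCons a p b q)
  have "mat (a + b) = mat a + (mat b :: cmat3)" by (simp add: mat3_simps)
  with pCons show ?case by (simp add: poly_mat_pCons matrix_add_ldistrib)
qed (simp add: poly_mat_0)

lemma poly_mat_smult: "poly_mat (smult c p) T = mat c ** poly_mat p T"
proof (induction p)
  case 0
  show ?case by (simp add: poly_mat_0 mat3_simps)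
next
  case (pCons a p)
  have "mat (c * a) = mat c ** (mat a :: cmat3)" by (simp add: mat3_simps)
  moreover have "mat c ** (T ** S) = T ** (mat c ** S)" for S :: cmat3
    by (simp add: matrix_mul_assoc mat_mult_commute)
  ultimately show ?case using pCons by (simp add: poly_mat_pCons matrix_add_ldistrib)
qed

lemma poly_mat_mult: "poly_mat (p * q) T = poly_mat p T ** poly_mat q T"
proof (induction p)
  case 0
  show ?case by (simp add: poly_mat_0 mat3_simps)
next
  case (pCons a p)
  have "mat 0 = (0 :: cmat3)" by (simp add: mat3_simps)
  with pCons show ?case
    by (simp add: poly_mat_pCons poly_mat_add poly_mat_smult matrix_add_mult_distrib matrix_mul_assoc)
qed

lemma poly_mat_const: "poly_mat [:c:] T = mat c"
  by (simp add: poly_mat_pCons poly_mat_0 mat3_simps)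

lemma poly_mat_diff: "poly_mat (p - q) T = poly_mat p T - poly_mat q T"
  using poly_mat_add[of "p - q" q T] by simp

lemma poly_mat_linear: "poly_mat [:z, -1:] T = mat z - T"
  by (simp add: poly_mat_pCons poly_mat_0 mat3_simps)

text \<open>The polynomial on the right depends on \<open>T\<close> only through the trace and
  \<open>e2\<close> of \<open>poly_mat p T\<close>, so matrices sharing these share it.\<close>

lemma adj3_poly_mat:
  "adj3 (poly_mat p T)
   = poly_mat (p * p - smult (trace (poly_mat p T)) p + [:e2 (poly_mat p T):]) T"
  by (simp only: adj3_def poly_mat_add poly_mat_diff poly_mat_mult poly_mat_smult poly_mat_const)

text \<open>The inverse of \<open>mat z - A\<close> is a polynomial \<open>r\<close> in
  \<open>A\<close>. Since \<open>S * r - [:1:]\<close> annihilates \<open>A\<close>, isometry makes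
  it annihilate \<open>B\<close>, so the same \<open>r\<close> inverts
  \<open>mat z - B\<close>.\<close>

lemma res_norm_eq_of_poly_isometric:
  assumes iso: "\<And>p. spec_norm (poly_mat p A) = spec_norm (poly_mat p B)"
    and d: "det (mat z - A) \<noteq> 0"
  shows "res_norm A z = res_norm B z"
proof -
  define S :: "complex poly" where "S = [:z, -1:]"
  have SA: "poly_mat S A = mat z - A" and SB: "poly_mat S B = mat z - B"
    by (simp_all add: S_def poly_mat_linear)
  obtain q where q: "adj3 (mat z - A) = poly_mat q A" using adj3_poly_mat[of S A] SA by metis
  define r where "r = smult (inverse (det (mat z - A))) q"
  have "poly_mat (S * r) A = mat (inverse (det (mat z - A))) ** ((mat z - A) ** adj3 (mat z - A))"
    by (simp add: poly_mat_mult SA r_def poly_mat_smult q matrix_mul_assoc mat_mult_commute)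
  also have "\<dots> = mat 1" unfolding mult_adj3 using d by (simp add: mat3_simps)
  finally have A1: "poly_mat (S * r) A = mat 1" .
  then have "poly_mat (S * r - [:1:]) A = 0" by (simp add: poly_mat_diff poly_mat_const)
  then have "poly_mat (S * r - [:1:]) B = 0" using iso spec_norm_eq_0_iff by metis
  then have B1: "poly_mat (S * r) B = mat 1" by (simp add: poly_mat_diff poly_mat_const)
  have iA: "(mat z - A) ** poly_mat r A = mat 1" and iB: "(mat z - B) ** poly_mat r B = mat 1"
    using A1 B1 by (simp_all add: poly_mat_mult SA SB)
  have "det (mat z - B) * det (poly_mat r B) = 1" using iB by (metis det_I det_mul)
  then have "det (mat z - B) \<noteq> 0" by auto
  with d show ?thesis by (simp add: res_norm_def matrix_inv_eqI[OF iA] matrix_inv_eqI[OF iB] iso)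
qed

section \<open>Scalar plus rank one\<close>

text \<open>The squared norm of the \<open>2 \<times> 2\<close> block with rows \<open>(a, t)\<close> and \<open>(0, b)\<close>, where
  \<open>u = |a|\<^sup>2\<close>, \<open>v = |b|\<^sup>2\<close> and \<open>k = |t|\<^sup>2\<close>.\<close>

definition block_sq :: "real \<Rightarrow> real \<Rightarrow> real \<Rightarrow> real" where
  "block_sq u v k = (u + v + k + sqrt ((u + v + k)\<^sup>2 - 4 * u * v)) / 2"

lemma block_sq_commute: "block_sq u v k = block_sq v u k"
  by (simp add: block_sq_def ac_simps)

context
  fixes u v k :: real
  assumes nn: "u \<ge> 0" "v \<ge> 0" "k \<ge> 0"
begin

lemma block_sq_discriminant: "(u + v + k)\<^sup>2 - 4 * u * v \<ge> (u - v)\<^sup>2"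
proof -
  have "(u + v + k)\<^sup>2 \<ge> (u + v)\<^sup>2" using nn by (intro power_mono) auto
  then show ?thesis by (simp add: power2_eq_square algebra_simps)
qed

text \<open>The cubic in \<open>spec_norm_rank1\<close> has \<open>u\<close> as a further root; this
  bound keeps it below the norm of the block.\<close>

lemma block_sq_ge: "u \<le> block_sq u v k"
proof -
  define D where "D = sqrt ((u + v + k)\<^sup>2 - 4 * u * v)"
  have "\<bar>u - v\<bar> \<le> D" unfolding D_def using real_sqrt_le_mono[OF block_sq_discriminant] by simp
  then have "2 * u \<le> u + v + k + D" using nn by linarith
  then show ?thesis unfolding block_sq_def D_def[symmetric] by simp
qed

lemma block_sq_root: "(block_sq u v k)\<^sup>2 - (u + v + k) * block_sq u v k + u * v = 0"
proof -
  define D where "D = sqrt ((u + v + k)\<^sup>2 - 4 * u * v)"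
  have "D\<^sup>2 = (u + v + k)\<^sup>2 - 4 * u * v"
    unfolding D_def using block_sq_discriminant zero_le_power2[of "u - v"] by (intro real_sqrt_pow2) linarith
  then show ?thesis unfolding block_sq_def D_def[symmetric] by (simp add: power2_eq_square field_simps)
qed

lemma block_sq_greatest:
  assumes "x\<^sup>2 - (u + v + k) * x + u * v = 0"
  shows "x \<le> block_sq u v k"
proof -
  have "(2 * x - (u + v + k))\<^sup>2 = (u + v + k)\<^sup>2 - 4 * u * v"
    using assms by (simp add: power2_eq_square algebra_simps)
  then have "2 * x - (u + v + k) \<le> sqrt ((u + v + k)\<^sup>2 - 4 * u * v)"
    by (metis abs_ge_self real_sqrt_abs)
  then show ?thesis by (simp add: block_sq_def)
qed

end

text \<open>At a positive root the quadratic equation is linear in \<open>k\<close> with nonzero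
  coefficient.\<close>

lemma block_sq_inject:
  assumes "u > 0" "v > 0" "k \<ge> 0" "k' \<ge> 0" "block_sq u v k = block_sq u v k'"
  shows "k = k'"
proof -
  have "block_sq u v k > 0" using block_sq_ge[of u v k] assms by simp
  moreover have "(u + v + k) * block_sq u v k = (u + v + k') * block_sq u v k"
    using block_sq_root[of u v k] block_sq_root[of u v k', folded assms(5)] assms by linarith
  ultimately show ?thesis by simp
qed

text \<open>For \<open>3 \<times> 3\<close> matrices, \<open>adj3 E = 0\<close> says that \<open>E\<close> has rank at most one.\<close>

context
  fixes E :: cmat3
  assumes adj: "adj3 E = 0"
begin

lemma rank1_e2: "e2 E = 0"
  using trace_adj3[of E] adj by (simp add: trace_def)

lemma rank1_det: "det E = 0"
  using det_adj3[of E] adj by (simp add: det_3)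

lemma rank1_square: "E ** E = mat (trace E) ** E"
  using adj rank1_e2 unfolding adj3_def by (simp add: mat3_simps)

text \<open>With \<open>adj3 E = 0\<close> the cubic collapses and the spectral and Frobenius norms
  of \<open>E\<close> agree. By \<open>rank1_square\<close> any nonzero \<open>E *v v\<close> is an
  eigenvector for \<open>trace E\<close>, whose modulus the norm therefore bounds.\<close>

lemma rank1_trace_le: "cmod (trace E) \<le> frob_norm E"
proof (cases "E = 0")
  case True
  then show ?thesis by (simp add: trace_def frob_norm_nonneg)
next
  case False
  define X where "X = (spec_norm E)\<^sup>2"
  have "X > 0" using False by (simp add: X_def spec_norm_eq_0_iff)
  have "frob_norm (adj3 E) = 0" by (simp add: adj frob_norm_def)
  then have "X^3 - (frob_norm E)\<^sup>2 * X\<^sup>2 = 0"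
    using spec_norm_root[of E] by (simp add: X_def rank1_det)
  then have "X = (frob_norm E)\<^sup>2" using \<open>X > 0\<close> by (simp add: power2_eq_square power3_eq_cube)
  then have X: "spec_norm E = frob_norm E"
    by (simp add: X_def spec_norm_nonneg frob_norm_nonneg power2_eq_iff_nonneg)
  obtain v where v: "norm v = 1" "norm (E *v v) = spec_norm E" using spec_norm_attained by blast
  have "E *v (E *v v) = trace E *s (E *v v)"
    by (metis matrix_vector_mul_assoc rank1_square mat_mult_vec)
  then have "cmod (trace E) * spec_norm E \<le> spec_norm E * spec_norm E"
    using norm_mult_vec_le[of E "E *v v"] v by (simp add: norm_scale_vec)
  then show ?thesis using X False spec_norm_nonneg[of E] spec_norm_eq_0_iff[of E] by simp
qed

text \<open>In suitable unitary coordinates the matrix is the scalar \<alpha> plus a triangular 2 by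
  2 block with diagonal \<alpha>, \<open>\<alpha> + \<beta> * trace E\<close>. The last argument is
  the squared modulus of the off-diagonal entry.\<close>

lemma spec_norm_rank1:
  "(spec_norm (mat \<alpha> + mat \<beta> ** E))\<^sup>2
   = block_sq ((cmod \<alpha>)\<^sup>2) ((cmod (\<alpha> + \<beta> * trace E))\<^sup>2)
       ((cmod \<beta>)\<^sup>2 * ((frob_norm E)\<^sup>2 - (cmod (trace E))\<^sup>2))"
proof -
  define T where "T = mat \<alpha> + mat \<beta> ** E"
  define u where "u = (cmod \<alpha>)\<^sup>2"
  define v where "v = (cmod (\<alpha> + \<beta> * trace E))\<^sup>2"
  define k where "k = (cmod \<beta>)\<^sup>2 * ((frob_norm E)\<^sup>2 - (cmod (trace E))\<^sup>2)"
  note cs = complex_norm_square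
  have nn: "u \<ge> 0" "v \<ge> 0" "k \<ge> 0"
    using rank1_trace_le by (auto simp: u_def v_def k_def power_mono)
  have uc: "of_real u = \<alpha> * cnj \<alpha>"
    and vc: "of_real v = (\<alpha> + \<beta> * trace E) * cnj (\<alpha> + \<beta> * trace E)"
    and kc: "of_real k = \<beta> * cnj \<beta> * (cip E E - trace E * cnj (trace E))"
    by (simp_all add: u_def v_def k_def cs cip_self del: of_real_power)
  have aT: "adj3 T = mat (\<alpha>\<^sup>2) + mat (\<alpha> * \<beta>) ** (mat (trace E) - E)"
    unfolding T_def adj3_mat_plus_scaled adj times0_right by simp
  have dT: "det T = \<alpha>\<^sup>2 * (\<alpha> + \<beta> * trace E)"
    by (simp add: T_def det_mat_plus_scaled rank1_det rank1_e2 power2_eq_square power3_eq_cube algebra_simps)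
  have "of_real ((frob_norm T)\<^sup>2) = complex_of_real (2 * u + v + k)"
    unfolding cip_self[symmetric] T_def by (simp add: cip_simps uc vc kc algebra_simps)
  then have F: "(frob_norm T)\<^sup>2 = 2 * u + v + k" unfolding of_real_eq_iff .
  have "of_real ((frob_norm (adj3 T))\<^sup>2) = complex_of_real (u * (u + v + k) + u * v)"
    unfolding cip_self[symmetric] aT by (simp add: cip_simps uc vc kc power2_eq_square algebra_simps)
  then have C: "(frob_norm (adj3 T))\<^sup>2 = u * (u + v + k) + u * v" unfolding of_real_eq_iff .
  have D: "(cmod (det T))\<^sup>2 = u\<^sup>2 * v"
    unfolding dT norm_mult norm_power u_def v_def by (simp add: power2_eq_square)
  \<comment> \<open>The root \<open>u\<close> belongs to the scalar direction, the quadratic factor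
    to the block.\<close>
  have factor: "x^3 - (frob_norm T)\<^sup>2 * x\<^sup>2 + (frob_norm (adj3 T))\<^sup>2 * x - (cmod (det T))\<^sup>2
    = (x - u) * (x\<^sup>2 - (u + v + k) * x + u * v)" for x
    unfolding F C D by (simp add: power2_eq_square power3_eq_cube algebra_simps)
  have "(spec_norm T)\<^sup>2 = u \<or> ((spec_norm T)\<^sup>2)\<^sup>2 - (u + v + k) * (spec_norm T)\<^sup>2 + u * v = 0"
    using spec_norm_root[of T] unfolding factor by simp
  then have "(spec_norm T)\<^sup>2 \<le> block_sq u v k"
    using block_sq_ge[OF nn] block_sq_greatest[OF nn] by metis
  moreover have "block_sq u v k \<le> (spec_norm T)\<^sup>2"
    by (rule spec_norm_greatest_root) (unfold factor, simp add: block_sq_root[OF nn])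
  ultimately show ?thesis by (simp add: T_def u_def v_def k_def)
qed

end

text \<open>The two hypotheses are the normal form used from here on: scalar plus rank at most one,
  with \<gamma> counted twice and \<delta> once as eigenvalues.\<close>

lemma det_rank1:
  assumes "adj3 (A - mat \<gamma>) = 0" "trace (A - mat \<gamma>) = \<delta> - \<gamma>"
  shows "det (mat z - A) = (z - \<gamma>)\<^sup>2 * (z - \<delta>)"
proof -
  have "mat z - A = mat (z - \<gamma>) + mat (-1) ** (A - mat \<gamma>)" by (simp add: mat3_simps)
  then have "det (mat z - A) = (z - \<gamma>)^3 - (z - \<gamma>)\<^sup>2 * (\<delta> - \<gamma>)"
    using assms(2) by (simp add: det_mat_plus_scaled rank1_e2[OF assms(1)] rank1_det[OF assms(1)])
  then show ?thesis by (simp add: power2_eq_square power3_eq_cube algebra_simps)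
qed

text \<open>The adjugate is \<open>mat (z - \<gamma>)\<close> times another scalar plus rank one
  matrix, in which \<gamma> and \<delta> have exchanged roles; one factor
  \<open>z - \<gamma>\<close> cancels against the determinant.\<close>

lemma res_norm_rank1:
  assumes "adj3 (A - mat \<gamma>) = 0" "trace (A - mat \<gamma>) = \<delta> - \<gamma>" "z \<noteq> \<gamma>" "z \<noteq> \<delta>"
  shows "res_norm A z = ereal (sqrt (block_sq ((cmod (z - \<delta>))\<^sup>2) ((cmod (z - \<gamma>))\<^sup>2)
      ((frob_norm (A - mat \<gamma>))\<^sup>2 - (cmod (\<delta> - \<gamma>))\<^sup>2)) / (cmod (z - \<gamma>) * cmod (z - \<delta>)))"
proof -
  let ?E = "A - mat \<gamma>"
  have "mat z - A = mat (z - \<gamma>) + mat (-1) ** ?E" by (simp add: mat3_simps)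
  then have "adj3 (mat z - A) = mat ((z - \<gamma>)\<^sup>2) - mat (z - \<gamma>) ** (mat (\<delta> - \<gamma>) - ?E)"
    using assms unfolding \<open>mat z - A = _\<close> adj3_mat_plus_scaled assms(1,2) by (simp add: mat3_simps algebra_simps)
  also have "\<dots> = mat (z - \<gamma>) ** (mat (z - \<delta>) + mat 1 ** ?E)"
    by (simp add: mat3_simps power2_eq_square algebra_simps)
  finally have a: "adj3 (mat z - A) = mat (z - \<gamma>) ** (mat (z - \<delta>) + mat 1 ** ?E)" .
  have "spec_norm (mat (z - \<delta>) + mat 1 ** ?E) = sqrt (block_sq ((cmod (z - \<delta>))\<^sup>2) ((cmod (z - \<gamma>))\<^sup>2)
      ((frob_norm ?E)\<^sup>2 - (cmod (\<delta> - \<gamma>))\<^sup>2))"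
    using spec_norm_rank1[OF assms(1), of "z - \<delta>" 1] assms(2)
    by (intro real_sqrt_unique[symmetric]) (simp_all add: spec_norm_nonneg)
  with assms show ?thesis
    by (simp add: res_norm_adj3 a det_rank1 spec_norm_scale norm_mult norm_power power2_eq_square)
qed

text \<open>Since \<open>A - mat \<gamma>\<close> squares to a multiple of itself, \<open>p\<close>
  may be replaced by its linear interpolant at \<gamma> and \<delta>.\<close>

lemma poly_mat_rank1:
  assumes "adj3 (A - mat \<gamma>) = 0" "trace (A - mat \<gamma>) = \<delta> - \<gamma>" "\<gamma> \<noteq> \<delta>"
  shows "poly_mat p A = mat (poly p \<gamma>) + mat ((poly p \<delta> - poly p \<gamma>) / (\<delta> - \<gamma>)) ** (A - mat \<gamma>)"
proof (induction p)
  case 0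
  then show ?case by (simp add: poly_mat_0 mat3_simps)
next
  case (pCons c p)
  define E where "E = A - mat \<gamma>"
  define b where "b = (poly p \<delta> - poly p \<gamma>) / (\<delta> - \<gamma>)"
  have b: "poly p \<delta> = poly p \<gamma> + b * (\<delta> - \<gamma>)" using assms(3) by (simp add: b_def)
  have "(poly (pCons c p) \<delta> - poly (pCons c p) \<gamma>) / (\<delta> - \<gamma>) = \<gamma> * b + poly p \<delta>"
    using assms(3) by (simp add: b_def field_simps)
  moreover have "E ** E = mat (\<delta> - \<gamma>) ** E"
    unfolding E_def using rank1_square[OF assms(1)] assms(2) by simp
  moreover have "mat c + (mat \<gamma> + E) ** (mat \<alpha> + mat b ** E)
    = mat (c + \<gamma> * \<alpha>) + mat (\<gamma> * b + \<alpha>) ** E + mat b ** (E ** E)" for \<alpha>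
    by (simp add: mat3_simps algebra_simps)
  moreover have "A = mat \<gamma> + E" by (simp add: E_def)
  moreover have "mat (\<gamma> * b + \<alpha>) ** E + mat b ** (mat \<tau> ** E) = mat (\<gamma> * b + (\<alpha> + b * \<tau>)) ** E" for \<alpha> \<tau>
    by (simp add: mat3_simps algebra_simps)
  ultimately show ?case
    unfolding poly_mat_pCons pCons.IH b_def[symmetric] E_def[symmetric] by (simp add: b add.assoc)
qed

section \<open>Isometry from equal characteristic polynomials and Gram matrices\<close>

lemma cip_comb_eq:
  assumes "trace U = trace U'" "trace V = trace V'" "cip U U = cip U' U'" "cip U V = cip U' V'"
    "cip V V = cip V' V'"
  shows "cip (mat \<alpha> + mat \<beta> ** U + mat \<gamma> ** V) (mat \<alpha> + mat \<beta> ** U + mat \<gamma> ** V)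
       = cip (mat \<alpha> + mat \<beta> ** U' + mat \<gamma> ** V') (mat \<alpha> + mat \<beta> ** U' + mat \<gamma> ** V')"
  using assms cip_commute[of V U] cip_commute[of V' U'] by (simp add: cip_simps)

text \<open>Multiplication by \<open>A\<close> in the spanning set \<open>I\<close>,
  \<open>A - mat t\<close>, \<open>adj3 A\<close>. Its coefficients involve only the characteristic
  polynomial, so they serve \<open>A\<close> and \<open>B\<close> alike.\<close>

lemma poly_mat_basis:
  assumes "trace A = t" "e2 A = s" "det A = d"
  shows "A ** (mat \<alpha> + mat \<beta> ** (A - mat t) + mat \<gamma> ** adj3 A)
    = mat (\<alpha> * t - \<beta> * s + \<gamma> * d) + mat \<alpha> ** (A - mat t) + mat \<beta> ** adj3 A"
proof -
  have "A ** (mat \<alpha> + mat \<beta> ** (A - mat t) + mat \<gamma> ** adj3 A)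
    = mat \<alpha> ** A + mat \<beta> ** (A ** A - mat t ** A) + mat \<gamma> ** (A ** adj3 A)"
    by (simp add: matrix_mul_assoc mat_mult_commute matrix_add_ldistrib) (simp add: mat3_simps algebra_simps)
  also have "A ** A - mat t ** A = adj3 A - mat s" using assms by (simp add: adj3_def)
  finally show ?thesis unfolding mult_adj3 assms by (simp add: mat3_simps algebra_simps)
qed

lemma poly_isometric_of_gram:
  assumes t: "trace A = trace B" and s: "e2 A = e2 B" and d: "det A = det B"
    and "cip (A - mat (trace A)) (A - mat (trace A)) = cip (B - mat (trace B)) (B - mat (trace B))"
    and "cip (A - mat (trace A)) (adj3 A) = cip (B - mat (trace B)) (adj3 B)"
    and "cip (adj3 A) (adj3 A) = cip (adj3 B) (adj3 B)"
  shows "spec_norm (poly_mat p A) = spec_norm (poly_mat p B)"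
proof -
  define U where "U T = T - mat (trace A)" for T :: cmat3
  have basis: "\<exists>\<alpha> \<beta> \<gamma>. poly_mat p A = mat \<alpha> + mat \<beta> ** U A + mat \<gamma> ** adj3 A
     \<and> poly_mat p B = mat \<alpha> + mat \<beta> ** U B + mat \<gamma> ** adj3 B" for p
  proof (induction p)
    case 0
    show ?case by (intro exI[of _ 0]) (simp add: poly_mat_0)
  next
    case (pCons c p)
    then obtain \<alpha> \<beta> \<gamma> where IH: "poly_mat p A = mat \<alpha> + mat \<beta> ** U A + mat \<gamma> ** adj3 A"
      "poly_mat p B = mat \<alpha> + mat \<beta> ** U B + mat \<gamma> ** adj3 B" by blast
    have add: "mat c + mat x = (mat (c + x) :: cmat3)" for x by (simp add: mat3_simps)
    show ?case unfolding poly_mat_pCons IH U_def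
      unfolding poly_mat_basis[OF refl refl refl, of A] poly_mat_basis[OF t[symmetric] s[symmetric] d[symmetric]]
        add.assoc[symmetric] add
      by blast
  qed
  have tr: "trace (U A) = trace (U B)" "trace (adj3 A) = trace (adj3 B)"
    by (simp_all add: U_def trace_sub t trace_adj3 s)
  have gram: "cip (U A) (U A) = cip (U B) (U B)" "cip (U A) (adj3 A) = cip (U B) (adj3 B)"
    "cip (adj3 A) (adj3 A) = cip (adj3 B) (adj3 B)"
    using assms(4-6) by (simp_all add: U_def t)
  have F: "frob_norm (poly_mat p A) = frob_norm (poly_mat p B)" for p
    using basis[of p] cip_comb_eq[OF tr gram] by (auto intro!: frob_norm_eqI)
  have T: "trace (poly_mat p A) = trace (poly_mat p B)" for p
    using basis[of p] tr by (auto simp: trace_add trace_scale)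
  have E: "e2 (poly_mat p A) = e2 (poly_mat p B)" for p
    unfolding e2_def poly_mat_mult[symmetric] T ..
  \<comment> \<open>Equal traces and equal \<open>e2\<close> give one polynomial \<open>q\<close>
    for both adjugates, so \<open>F\<close> also controls their Frobenius norms.\<close>
  obtain q where q: "adj3 (poly_mat p A) = poly_mat q A" "adj3 (poly_mat p B) = poly_mat q B"
    using adj3_poly_mat[of p A] adj3_poly_mat[of p B] unfolding T E by blast
  \<comment> \<open>A matrix times its adjugate is the scalar matrix of its determinant, so this
    trace is three times the determinant.\<close>
  have "trace (poly_mat p A ** adj3 (poly_mat p A)) = trace (poly_mat p B ** adj3 (poly_mat p B))"
    unfolding q poly_mat_mult[symmetric] by (rule T)
  then have "det (poly_mat p A) = det (poly_mat p B)" unfolding mult_adj3 trace_mat by simp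
  then show ?thesis using F[of p] F[of q] by (intro spec_norm_eqI) (simp_all add: q)
qed

section \<open>Identical pseudospectra\<close>

text \<open>One root comes from the fundamental theorem of algebra, the other two from the quadratic
  formula.\<close>

lemma det_mat_minus_factor:
  "\<exists>a1 a2 a3. \<forall>z. det (mat z - T :: cmat3) = (z - a1) * (z - a2) * (z - a3)"
proof -
  let ?p = "[:- det T, e2 T, - trace T, 1:]"
  have p: "poly ?p z = det (mat z - T)" for z
    by (simp add: det_mat_minus power2_eq_square power3_eq_cube algebra_simps)
  have "\<not> constant (poly ?p)" by (simp add: constant_degree)
  then obtain a where "poly ?p a = 0" using fundamental_theorem_of_algebra by blast
  then have a: "a^3 - trace T * a\<^sup>2 + e2 T * a - det T = 0" by (simp only: p det_mat_minus)
  \<comment> \<open>\<open>b\<close> and \<open>c\<close> are the coefficients of the quotient by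
    \<open>z - a\<close>.\<close>
  define b where "b = a - trace T"
  define c where "c = e2 T + a * b"
  define r where "r = csqrt (b\<^sup>2 - 4 * c)"
  have r: "r\<^sup>2 = b\<^sup>2 - 4 * c" by (simp add: r_def)
  have "det (mat z - T) = (z - a) * (z - (- b + r) / 2) * (z - (- b - r) / 2)" for z
  proof -
    have "(z - (- b + r) / 2) * (z - (- b - r) / 2) = z\<^sup>2 + b * z + (b\<^sup>2 - r\<^sup>2) / 4"
      by (simp add: power2_eq_square field_simps)
    also have "\<dots> = z\<^sup>2 + b * z + c" by (simp add: r)
    finally have "(z - a) * (z - (- b + r) / 2) * (z - (- b - r) / 2) = (z - a) * (z\<^sup>2 + b * z + c)"
      by (simp only: mult.assoc)
    also have "\<dots> = det (mat z - T)"
      using a unfolding det_mat_minus b_def c_def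
      by (simp add: power2_eq_square power3_eq_cube algebra_simps)
    finally show ?thesis ..
  qed
  then show ?thesis by blast
qed

lemma finite_det_mat_minus: "finite {z. det (mat z - T :: cmat3) = 0}"
proof -
  obtain a1 a2 a3 where "\<And>z. det (mat z - T) = (z - a1) * (z - a2) * (z - a3)"
    using det_mat_minus_factor by blast
  then have "{z. det (mat z - T) = 0} \<subseteq> {a1, a2, a3}" by auto
  then show ?thesis by (rule finite_subset) simp
qed

text \<open>With three roots counted, multiplicities on a common root set can differ only if there
  are two distinct roots, with multiplicities 2, 1 and 1, 2.\<close>

lemma same_roots_cubic:
  fixes a1 a2 a3 b1 b2 b3 :: complex
  assumes "{a1, a2, a3} = {b1, b2, b3}"
  shows "(\<forall>z. (z - a1) * (z - a2) * (z - a3) = (z - b1) * (z - b2) * (z - b3)) \<or>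
    (\<exists>a b. a \<noteq> b \<and> (\<forall>z. (z - a1) * (z - a2) * (z - a3) = (z - a)\<^sup>2 * (z - b)
       \<and> (z - b1) * (z - b2) * (z - b3) = (z - b)\<^sup>2 * (z - a)))"
proof -
  \<comment> \<open>\<open>P\<close> lists the arrangements of x, x, y among the first roots,
    \<open>Q\<close> those of y, y, x among the second.\<close>
  define P where "P x y \<longleftrightarrow> (a1 = x \<and> a2 = x \<and> a3 = y) \<or> (a1 = x \<and> a2 = y \<and> a3 = x) \<or> (a1 = y \<and> a2 = x \<and> a3 = x)" for x y
  define Q where "Q x y \<longleftrightarrow> (b1 = y \<and> b2 = y \<and> b3 = x) \<or> (b1 = y \<and> b2 = x \<and> b3 = y) \<or> (b1 = x \<and> b2 = y \<and> b3 = y)" for x y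
  have mem: "a1 = b1 \<or> a1 = b2 \<or> a1 = b3" "a2 = b1 \<or> a2 = b2 \<or> a2 = b3" "a3 = b1 \<or> a3 = b2 \<or> a3 = b3"
    "b1 = a1 \<or> b1 = a2 \<or> b1 = a3" "b2 = a1 \<or> b2 = a2 \<or> b2 = a3" "b3 = a1 \<or> b3 = a2 \<or> b3 = a3"
    using assms by blast+
  have "((b1 = a1 \<and> b2 = a2 \<and> b3 = a3) \<or> (b1 = a1 \<and> b2 = a3 \<and> b3 = a2) \<or> (b1 = a2 \<and> b2 = a1 \<and> b3 = a3)
    \<or> (b1 = a2 \<and> b2 = a3 \<and> b3 = a1) \<or> (b1 = a3 \<and> b2 = a1 \<and> b3 = a2) \<or> (b1 = a3 \<and> b2 = a2 \<and> b3 = a1))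
    \<or> (a1 \<noteq> a3 \<and> P a1 a3 \<and> Q a1 a3) \<or> (a1 \<noteq> a2 \<and> P a1 a2 \<and> Q a1 a2) \<or> (a2 \<noteq> a1 \<and> P a2 a1 \<and> Q a2 a1)"
    (is "?perm \<or> ?double")
    using mem unfolding P_def Q_def by smt
  then show ?thesis
  proof
    assume ?perm
    then show ?thesis by (elim disjE conjE) (simp_all add: mult_ac)
  next
    assume ?double
    then obtain x y where "x \<noteq> y" "P x y" "Q x y" by blast
    moreover from \<open>P x y\<close> have "(z - a1) * (z - a2) * (z - a3) = (z - x)\<^sup>2 * (z - y)" for z
      unfolding P_def by (elim disjE conjE) (simp_all add: power2_eq_square)
    moreover from \<open>Q x y\<close> have "(z - b1) * (z - b2) * (z - b3) = (z - y)\<^sup>2 * (z - x)" for z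
      unfolding Q_def by (elim disjE conjE) (simp_all add: power2_eq_square)
    ultimately show ?thesis by blast
  qed
qed

lemma continuous_adj3_component: "continuous_on UNIV (\<lambda>z. adj3 (mat z - T) $ i $ j)"
proof -
  have "(\<lambda>z. adj3 (mat z - T) $ i $ j)
    = (\<lambda>z. (if i = j then 1 else 0) * z\<^sup>2 + z * (T - mat (trace T)) $ i $ j + adj3 T $ i $ j)"
    unfolding adj3_mat_minus vector_add_component mat_mult_component by (simp add: mat_def fun_eq_iff)
  then show ?thesis by (simp only:) (intro continuous_intros)
qed

text \<open>Apply the adjugate to \<open>(mat z - A) *v v = (z - a) *s v\<close> for an eigenvector
  \<open>v\<close>. Off the spectrum this bounds the least singular value of
  \<open>mat z - A\<close> by \<open>cmod (z - a)\<close>.\<close>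

lemma det_le_spec_norm_adj3:
  assumes "det (mat a - A) = 0"
  shows "cmod (det (mat z - A)) \<le> cmod (z - a) * spec_norm (adj3 (mat z - A))"
proof -
  obtain v where v: "v \<noteq> 0" "(mat a - A) *v v = 0" using assms det_eq_0_iff_kernel by blast
  have "mat z - A = mat (z - a) + (mat a - A)" by (simp add: mat3_simps)
  then have "(mat z - A) *v v = mat (z - a) *v v + (mat a - A) *v v"
    by (metis matrix_vector_mult_add_rdistrib)
  then have "(mat z - A) *v v = (z - a) *s v" using v(2) by (simp only: mat_mult_vec add_0_right)
  then have "adj3 (mat z - A) *v ((z - a) *s v) = det (mat z - A) *s v"
    by (metis adj3_mult mat_mult_vec matrix_vector_mul_assoc)
  then have "cmod (det (mat z - A)) * norm v \<le> spec_norm (adj3 (mat z - A)) * (cmod (z - a) * norm v)"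
    using norm_mult_vec_le[of "adj3 (mat z - A)" "(z - a) *s v"] by (simp only: norm_scale_vec)
  then show ?thesis using v by (simp add: mult_ac)
qed

text \<open>Cancelling the quadratic terms in the second bound leaves a real linear function of
  \<open>z\<close> bounded above, so its coefficient vanishes; the first bound at
  \<open>z = a\<close> and the second at 0 then fix \<open>k\<close>.\<close>

lemma squeeze_norm_square:
  assumes "\<And>z. 0 \<le> (cmod z)\<^sup>2 + 2 * Re (z * h) + k"
    and "\<And>z. (cmod z)\<^sup>2 + 2 * Re (z * h) + k \<le> (cmod (z - a))\<^sup>2"
  shows "h = - cnj a \<and> k = (cmod a)\<^sup>2"
proof -
  define g where "g = h + cnj a"
  have sq: "(cmod (z - a))\<^sup>2 = (cmod z)\<^sup>2 - 2 * Re (z * cnj a) + (cmod a)\<^sup>2" for z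
    unfolding cmod_power2 by (simp add: power2_eq_square algebra_simps)
  have le: "2 * Re (z * g) \<le> (cmod a)\<^sup>2 - k" for z
    using assms(2)[of z] unfolding sq by (simp add: g_def algebra_simps)
  have "g = 0"
  proof (rule ccontr)
    assume "g \<noteq> 0"
    \<comment> \<open>Chosen so that at \<open>of_real t * cnj g\<close> the left side of
      \<open>le\<close> exceeds the bound by exactly 1.\<close>
    define t where "t = ((cmod a)\<^sup>2 - k + 1) / (2 * (cmod g)\<^sup>2)"
    have "2 * Re (of_real t * cnj g * g) = 2 * t * (cmod g)\<^sup>2"
      unfolding cmod_power2 by (simp add: power2_eq_square algebra_simps)
    also have "\<dots> = (cmod a)\<^sup>2 - k + 1" using \<open>g \<noteq> 0\<close> by (simp add: t_def)
    finally show False using le[of "of_real t * cnj g"] by simp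
  qed
  then have h: "h = - cnj a" by (simp add: g_def eq_neg_iff_add_eq_0)
  have "k \<le> (cmod a)\<^sup>2" using le[of 0] by simp
  moreover have "(cmod a)\<^sup>2 \<le> k" using assms(1)[of a] unfolding h cmod_power2
    by (simp add: power2_eq_square)
  ultimately show ?thesis using h by simp
qed

lemma frob_norm_scale_square: "(frob_norm (mat c ** T))\<^sup>2 = (cmod c)\<^sup>2 * (frob_norm T)\<^sup>2"
proof -
  have "of_real ((frob_norm (mat c ** T))\<^sup>2) = complex_of_real ((cmod c)\<^sup>2 * (frob_norm T)\<^sup>2)"
    unfolding cip_self[symmetric] cip_scale_left cip_scale_right of_real_mult complex_norm_square
    by (simp add: mult_ac)
  then show ?thesis unfolding of_real_eq_iff .
qed

text \<open>As \<open>z\<close> tends to \<open>a\<close> the right side vanishes while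
  \<open>cmod (z - b)\<close> stays away from 0, so the adjugate must vanish at
  \<open>a\<close>.\<close>

lemma adj3_eq_0_of_adj3_norm_ratio:
  assumes res: "\<And>z. z \<notin> {a, b} \<Longrightarrow>
      spec_norm (adj3 (mat z - A)) * cmod (z - b) = spec_norm (adj3 (mat z - B)) * cmod (z - a)"
    and "a \<noteq> b"
  shows "adj3 (A - mat a) = 0"
proof -
  \<comment> \<open>Passing from spectral norms to entries makes continuity of both sides
    immediate.\<close>
  have *: "cmod (adj3 (mat z - A) $ i $ j) * cmod (z - b)
     \<le> (\<Sum>k\<in>UNIV. \<Sum>l\<in>UNIV. cmod (adj3 (mat z - B) $ k $ l)) * cmod (z - a)" for i j z
  proof (rule le_off_finite[where F = "{a, b}" and z = z])
    fix z assume "z \<notin> {a, b}"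
    have "cmod (adj3 (mat z - A) $ i $ j) * cmod (z - b) \<le> spec_norm (adj3 (mat z - A)) * cmod (z - b)"
      by (intro mult_right_mono cmod_component_le_spec_norm) simp
    also have "\<dots> = spec_norm (adj3 (mat z - B)) * cmod (z - a)" using res \<open>z \<notin> {a, b}\<close> by blast
    also have "\<dots> \<le> (\<Sum>k\<in>UNIV. \<Sum>l\<in>UNIV. cmod (adj3 (mat z - B) $ k $ l)) * cmod (z - a)"
      by (intro mult_right_mono spec_norm_le_sum) simp
    finally show "cmod (adj3 (mat z - A) $ i $ j) * cmod (z - b)
      \<le> (\<Sum>k\<in>UNIV. \<Sum>l\<in>UNIV. cmod (adj3 (mat z - B) $ k $ l)) * cmod (z - a)" .
  next
    show "continuous_on UNIV (\<lambda>z. cmod (adj3 (mat z - A) $ i $ j) * cmod (z - b))"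
      by (intro continuous_intros continuous_adj3_component)
    show "continuous_on UNIV (\<lambda>z. (\<Sum>k\<in>UNIV. \<Sum>l\<in>UNIV. cmod (adj3 (mat z - B) $ k $ l)) * cmod (z - a))"
      by (intro continuous_intros continuous_adj3_component)
  qed simp
  have "adj3 (mat a - A) = 0" using *[where z = a] \<open>a \<noteq> b\<close> by (simp add: vec_eq_iff mult_le_0_iff)
  moreover have "adj3 (A - mat a) = adj3 (mat a - A)"
    by (simp add: vec_eq_iff forall_3 adj3_minors algebra_simps)
  ultimately show ?thesis by simp
qed

text \<open>Both resolvent norms are one function of \<open>z\<close> and of \<open>k\<close> or
  \<open>k'\<close>. Exchanged eigenvalues do no harm because \<open>block_sq\<close> is symmetric
  in its first two arguments.\<close>

lemma res_norm_rank1_eq_iff: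
  assumes A: "adj3 (A - mat \<gamma>) = 0" "trace (A - mat \<gamma>) = \<delta> - \<gamma>"
    and B: "adj3 (B - mat \<gamma>') = 0" "trace (B - mat \<gamma>') = \<delta>' - \<gamma>'"
    and same: "\<gamma>' = \<gamma> \<and> \<delta>' = \<delta> \<or> \<gamma>' = \<delta> \<and> \<delta>' = \<gamma>"
  shows "(\<forall>z. res_norm A z = res_norm B z) \<longleftrightarrow> frob_norm (A - mat \<gamma>) = frob_norm (B - mat \<gamma>')"
proof -
  define k where "k = (frob_norm (A - mat \<gamma>))\<^sup>2 - (cmod (\<delta> - \<gamma>))\<^sup>2"
  define k' where "k' = (frob_norm (B - mat \<gamma>'))\<^sup>2 - (cmod (\<delta> - \<gamma>))\<^sup>2"
  have eq: "(cmod (\<delta>' - \<gamma>'))\<^sup>2 = (cmod (\<delta> - \<gamma>))\<^sup>2" using same by (auto simp: norm_minus_commute)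
  have k: "frob_norm (A - mat \<gamma>) = frob_norm (B - mat \<gamma>') \<longleftrightarrow> k = k'"
    by (simp add: k_def k'_def frob_norm_nonneg)
  have k0: "k \<ge> 0" "k' \<ge> 0"
    using power_mono[OF rank1_trace_le[OF A(1)], of 2] power_mono[OF rank1_trace_le[OF B(1)], of 2]
    unfolding A(2) B(2) eq by (simp_all add: k_def k'_def)
  let ?r = "\<lambda>z k. ereal (sqrt (block_sq ((cmod (z - \<delta>))\<^sup>2) ((cmod (z - \<gamma>))\<^sup>2) k) / (cmod (z - \<gamma>) * cmod (z - \<delta>)))"
  have rA: "res_norm A z = ?r z k" if "z \<noteq> \<gamma>" "z \<noteq> \<delta>" for z
    using res_norm_rank1[OF A that] by (simp add: k_def)
  have rB: "res_norm B z = ?r z k'" if "z \<noteq> \<gamma>" "z \<noteq> \<delta>" for z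
    using same
  proof (elim disjE conjE)
    assume "\<gamma>' = \<gamma>" "\<delta>' = \<delta>"
    then show ?thesis using res_norm_rank1[OF B, of z] that by (simp add: k'_def)
  next
    assume "\<gamma>' = \<delta>" "\<delta>' = \<gamma>"
    then show ?thesis
      using res_norm_rank1[OF B, of z] that block_sq_commute[of "(cmod (z - \<gamma>))\<^sup>2" "(cmod (z - \<delta>))\<^sup>2" k'] eq
      by (simp add: k'_def mult.commute)
  qed
  show ?thesis unfolding k
  proof
    assume res: "\<forall>z. res_norm A z = res_norm B z"
    \<comment> \<open>A single point off the spectrum suffices, since \<open>block_sq\<close> is
      injective in its last argument there.\<close>
    obtain z where z: "z \<notin> {\<gamma>, \<delta>}" using ex_new_if_finite[of "{\<gamma>, \<delta>}"] infinite_UNIV_char_0 by blast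
    then have z': "z \<noteq> \<gamma>" "z \<noteq> \<delta>" by auto
    have "?r z k = ?r z k'" using rA[OF z'] rB[OF z'] res by metis
    then have "block_sq ((cmod (z - \<delta>))\<^sup>2) ((cmod (z - \<gamma>))\<^sup>2) k = block_sq ((cmod (z - \<delta>))\<^sup>2) ((cmod (z - \<gamma>))\<^sup>2) k'"
      using z' by simp
    then show "k = k'" by (rule block_sq_inject[rotated 4]) (use z' k0 in auto)
  next
    assume "k = k'"
    show "\<forall>z. res_norm A z = res_norm B z"
    proof
      fix z
      show "res_norm A z = res_norm B z"
      proof (cases "z = \<gamma> \<or> z = \<delta>")
        case True
        then have "det (mat z - A) = 0" "det (mat z - B) = 0"
          unfolding det_rank1[OF A] det_rank1[OF B] using same by auto
        then show ?thesis by (simp add: res_norm_def)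
      next
        case False
        then show ?thesis using rA rB \<open>k = k'\<close> by simp
      qed
    qed
  qed
qed

text \<open>The divided difference \<beta> of \<open>p\<close> is symmetric in \<open>a\<close> and
  \<open>b\<close>, so passing from \<open>A\<close> to \<open>B\<close> only exchanges the diagonal
  entries of the block.\<close>

lemma poly_isometric_rank1:
  assumes A: "adj3 (A - mat a) = 0" "trace (A - mat a) = b - a"
    and B: "adj3 (B - mat b) = 0" "trace (B - mat b) = a - b"
    and "a \<noteq> b" and f: "frob_norm (A - mat a) = frob_norm (B - mat b)"
  shows "spec_norm (poly_mat p A) = spec_norm (poly_mat p B)"
proof -
  define \<beta> where "\<beta> = (poly p b - poly p a) / (b - a)"
  have \<beta>: "\<beta> = (poly p a - poly p b) / (a - b)"
    using \<open>a \<noteq> b\<close> by (simp add: \<beta>_def field_simps)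
  have ab: "poly p a + \<beta> * (b - a) = poly p b" "poly p b + \<beta> * (a - b) = poly p a"
    using \<open>a \<noteq> b\<close> by (simp_all add: \<beta>_def) (simp add: field_simps)
  have "poly_mat p A = mat (poly p a) + mat \<beta> ** (A - mat a)"
    using poly_mat_rank1[OF A \<open>a \<noteq> b\<close>] by (simp add: \<beta>_def)
  moreover have "poly_mat p B = mat (poly p b) + mat \<beta> ** (B - mat b)"
    using poly_mat_rank1[OF B] \<open>a \<noteq> b\<close> by (simp add: \<beta>)
  ultimately have "(spec_norm (poly_mat p A))\<^sup>2 = (spec_norm (poly_mat p B))\<^sup>2"
    using spec_norm_rank1[OF A(1)] spec_norm_rank1[OF B(1)] f ab
      block_sq_commute[of "(cmod (poly p a))\<^sup>2" "(cmod (poly p b))\<^sup>2"]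
    by (simp add: A(2) B(2) norm_minus_commute[of a b])
  then show ?thesis by (simp add: power2_eq_iff_nonneg spec_norm_nonneg)
qed

lemma res_norm_infinite_iff: "res_norm A z = \<infinity> \<longleftrightarrow> det (mat z - A) = 0"
  by (simp add: res_norm_def)

lemma trace_of_char:
  assumes "adj3 (A - mat a) = 0" "\<And>z. det (mat z - A) = (z - a)\<^sup>2 * (z - b)"
  shows "trace (A - mat a) = b - a"
proof -
  define d where "d = a + trace (A - mat a)"
  have "det (mat z - A) = (z - a)\<^sup>2 * (z - d)" for z
    by (rule det_rank1[OF assms(1)]) (simp add: d_def)
  \<comment> \<open>At \<open>a + 1\<close> the squared factor is 1, which leaves the linear factors
    to compare.\<close>
  from this[of "a + 1"] assms(2)[of "a + 1"] have "b = d" by simp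
  then show ?thesis by (simp add: d_def)
qed

lemma poly_isometric_of_res_norm_distinct_char:
  assumes res: "\<And>z. res_norm A z = res_norm B z" and "a \<noteq> b"
    and dA: "\<And>z. det (mat z - A) = (z - a)\<^sup>2 * (z - b)"
    and dB: "\<And>z. det (mat z - B) = (z - b)\<^sup>2 * (z - a)"
  shows "spec_norm (poly_mat p A) = spec_norm (poly_mat p B)"
proof -
  \<comment> \<open>Cancel the factor \<open>cmod (z - a) * cmod (z - b)\<close> common to both
    determinants.\<close>
  have key: "spec_norm (adj3 (mat z - A)) * cmod (z - b) = spec_norm (adj3 (mat z - B)) * cmod (z - a)"
    if "z \<notin> {a, b}" for z
  proof -
    have "z \<noteq> a" "z \<noteq> b" using that by auto
    moreover from this have "spec_norm (adj3 (mat z - A)) / cmod (det (mat z - A))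
       = spec_norm (adj3 (mat z - B)) / cmod (det (mat z - B))"
      using res[of z] by (simp add: res_norm_adj3 dA dB)
    ultimately show ?thesis
      unfolding dA dB norm_mult norm_power by (simp add: field_simps power2_eq_square)
  qed
  have A: "adj3 (A - mat a) = 0" by (rule adj3_eq_0_of_adj3_norm_ratio[OF key \<open>a \<noteq> b\<close>])
  have B: "adj3 (B - mat b) = 0"
    by (rule adj3_eq_0_of_adj3_norm_ratio[of b a B A]) (use key \<open>a \<noteq> b\<close> in auto)
  note A = A trace_of_char[OF A dA] and B = B trace_of_char[OF B dB]
  show ?thesis
    using res_norm_rank1_eq_iff[OF A B] res by (intro poly_isometric_rank1[OF A B \<open>a \<noteq> b\<close>]) auto
qed

text \<open>For equal characteristic polynomials, only the terms with \<open>cip\<close> survive in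
  the difference of two such expansions.\<close>

lemma frob_adj3_mat_minus:
  "of_real ((frob_norm (adj3 (mat z - A)))\<^sup>2) =
   3 * (z * cnj z)\<^sup>2 + z * cnj z * cip A A + (z * cnj z) * trace A * cnj (trace A)
   - 2 * z * cnj z * (z * cnj (trace A) + cnj z * trace A)
   + z\<^sup>2 * cnj (e2 A) + (cnj z)\<^sup>2 * e2 A
   + z * cip (A - mat (trace A)) (adj3 A) + cnj (z * cip (A - mat (trace A)) (adj3 A))
   + cip (adj3 A) (adj3 A)"
proof -
  define U where "U = A - mat (trace A)"
  have U: "trace U = - 2 * trace A" "cip U U = cip A A + trace A * cnj (trace A)"
    by (simp_all add: U_def cip_simps algebra_simps)
  show ?thesis unfolding cip_self[symmetric] adj3_mat_minus U_def[symmetric]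
    using cip_commute[of "adj3 A" U]
    by (simp add: cip_simps U trace_adj3 power2_eq_square algebra_simps)
qed

text \<open>The limit at \<open>a\<close> is taken twice: first it gives
  \<open>adj3 (A - mat a) = 0\<close>; then the adjugate has a factor \<open>z - a\<close>, and
  after cancelling it the limit kills \<open>A - mat a\<close> itself.\<close>

lemma mat_eq_of_adj3_bound:
  assumes d: "\<And>z. det (mat z - A) = (z - a)^3"
    and le: "\<And>z. z \<noteq> a \<Longrightarrow> spec_norm (adj3 (mat z - A)) \<le> (cmod (z - a))\<^sup>2"
  shows "A = mat a"
proof -
  have "cmod (adj3 (mat z - A) $ i $ j) \<le> (cmod (z - a))\<^sup>2" for z i j
    by (rule le_off_finite[where F = "{a}" and z = z and f = "\<lambda>z. cmod (adj3 (mat z - A) $ i $ j)"])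
       (auto intro!: continuous_intros continuous_adj3_component
         intro: order_trans[OF cmod_component_le_spec_norm le])
  from this[of a] have "adj3 (mat a - A) = 0" by (simp add: vec_eq_iff)
  moreover have "adj3 (A - mat a) = adj3 (mat a - A)"
    by (simp add: vec_eq_iff forall_3 adj3_minors algebra_simps)
  ultimately have N: "adj3 (A - mat a) = 0" by simp
  have tr: "trace (A - mat a) = a - a"
    by (rule trace_of_char[OF N]) (simp add: d power2_eq_square power3_eq_cube)
  have *: "cmod ((mat (z - a) + (A - mat a)) $ i $ j) \<le> cmod (z - a)" if "z \<notin> {a}" for z i j
  proof -
    have za: "z \<noteq> a" using that by simp
    have "mat z - A = mat (z - a) + mat (-1) ** (A - mat a)" by (simp add: mat3_simps)
    then have "adj3 (mat z - A) = mat ((z - a)\<^sup>2) - mat (z - a) ** (mat 0 - (A - mat a))"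
      by (simp only: adj3_mat_plus_scaled N tr) (simp add: mat3_simps algebra_simps)
    also have "\<dots> = mat (z - a) ** (mat (z - a) + (A - mat a))"
      by (simp add: mat3_simps power2_eq_square algebra_simps)
    finally have "cmod (z - a) * spec_norm (mat (z - a) + (A - mat a)) \<le> cmod (z - a) * cmod (z - a)"
      using le[OF za] by (simp add: spec_norm_scale power2_eq_square)
    then have "spec_norm (mat (z - a) + (A - mat a)) \<le> cmod (z - a)" using za by simp
    then show ?thesis by (rule order_trans[OF cmod_component_le_spec_norm])
  qed
  have "cmod ((mat (z - a) + (A - mat a)) $ i $ j) \<le> cmod (z - a)" for z i j
  proof (rule le_off_finite[where F = "{a}" and z = z and f = "\<lambda>z. cmod ((mat (z - a) + (A - mat a)) $ i $ j)"])
    have "(\<lambda>z. cmod ((mat (z - a) + (A - mat a)) $ i $ j))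
      = (\<lambda>z. cmod ((if i = j then 1 else 0) * (z - a) + (A - mat a) $ i $ j))"
      by (simp add: mat_def fun_eq_iff)
    then show "continuous_on UNIV (\<lambda>z. cmod ((mat (z - a) + (A - mat a)) $ i $ j))"
      by (simp only:) (intro continuous_intros)
  next
    show "continuous_on UNIV (\<lambda>z. cmod (z - a))" by (intro continuous_intros)
  qed (simp, rule *)
  from this[of a] show ?thesis by (simp add: vec_eq_iff)
qed

text \<open>This and the next two definitions are the coefficients d1, h and k of the difference d2
  in the opening outline.\<close>

definition frob_diff :: "cmat3 \<Rightarrow> cmat3 \<Rightarrow> real" where
  "frob_diff A B = (frob_norm A)\<^sup>2 - (frob_norm B)\<^sup>2"

definition cross_diff :: "cmat3 \<Rightarrow> cmat3 \<Rightarrow> complex" where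
  "cross_diff A B = cip (A - mat (trace A)) (adj3 A) - cip (B - mat (trace B)) (adj3 B)"

definition adj_frob_diff :: "cmat3 \<Rightarrow> cmat3 \<Rightarrow> real" where
  "adj_frob_diff A B = (frob_norm (adj3 A))\<^sup>2 - (frob_norm (adj3 B))\<^sup>2"

section \<open>Resolvent norms for equal characteristic polynomials\<close>

context
  fixes A B :: cmat3
  assumes chi: "\<And>z. det (mat z - A) = det (mat z - B)"
begin

lemma char_coeffs: "det A = det B" "trace A = trace B" "e2 A = e2 B"
proof -
  show d: "det A = det B" using chi[of 0] unfolding det_mat_minus by simp
  have 1: "e2 A - trace A = e2 B - trace B" using chi[of 1] d unfolding det_mat_minus by (simp add: algebra_simps)
  have 2: "e2 A + trace A = e2 B + trace B" using chi[of "-1"] d unfolding det_mat_minus by (simp add: algebra_simps)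
  have "2 * trace A = 2 * trace B" "2 * e2 A = 2 * e2 B"
    using arg_cong2[OF 1 2, of "\<lambda>x y. y - x"] arg_cong2[OF 1 2, of "(+)"] by simp_all
  then show "trace A = trace B" "e2 A = e2 B" by simp_all
qed

lemma frob_shift_diff: "(frob_norm (mat z - A))\<^sup>2 - (frob_norm (mat z - B))\<^sup>2 = frob_diff A B"
proof -
  have "complex_of_real ((frob_norm (mat z - A))\<^sup>2 - (frob_norm (mat z - B))\<^sup>2) = of_real (frob_diff A B)"
    unfolding frob_diff_def of_real_diff cip_self[symmetric] by (simp add: cip_simps char_coeffs)
  then show ?thesis unfolding of_real_eq_iff .
qed

lemma frob_adj3_diff:
  "(frob_norm (adj3 (mat z - A)))\<^sup>2 - (frob_norm (adj3 (mat z - B)))\<^sup>2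
   = frob_diff A B * (cmod z)\<^sup>2 + 2 * Re (z * cross_diff A B) + adj_frob_diff A B"
proof -
  have "complex_of_real ((frob_norm (adj3 (mat z - A)))\<^sup>2 - (frob_norm (adj3 (mat z - B)))\<^sup>2)
    = (cip A A - cip B B) * (z * cnj z) + (z * cross_diff A B + cnj (z * cross_diff A B)) + (cip (adj3 A) (adj3 A) - cip (adj3 B) (adj3 B))"
    unfolding of_real_diff frob_adj3_mat_minus cross_diff_def by (simp add: char_coeffs algebra_simps)
  also have "\<dots> = of_real (frob_diff A B * (cmod z)\<^sup>2 + 2 * Re (z * cross_diff A B) + adj_frob_diff A B)"
    unfolding complex_add_cnj complex_norm_square[symmetric] cip_self frob_diff_def adj_frob_diff_def
    by simp
  finally show ?thesis unfolding of_real_eq_iff .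
qed

context
  assumes res: "\<And>z. res_norm A z = res_norm B z"
begin

text \<open>\<open>X\<close> is a root of the cubics of both adjugates. Subtraction removes the
  cubic and constant terms, and a factor \<open>X\<close> cancels.\<close>

lemma resolvent_norm_equation:
  assumes d: "det (mat z - A) \<noteq> 0"
  defines "X \<equiv> (spec_norm (adj3 (mat z - A)))\<^sup>2"
  shows "X > 0" "(frob_diff A B * (cmod z)\<^sup>2 + 2 * Re (z * cross_diff A B) + adj_frob_diff A B) * X
      = frob_diff A B * (cmod (det (mat z - A)))\<^sup>2"
proof -
  let ?D = "(cmod (det (mat z - A)))\<^sup>2"
  have "adj3 (mat z - A) \<noteq> 0"
  proof
    assume "adj3 (mat z - A) = 0"
    then have "det (mat z - A) = 0" by (rule rank1_det)
    with d show False by simp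
  qed
  then show X0: "X > 0" by (simp add: X_def spec_norm_eq_0_iff)
  have XB: "X = (spec_norm (adj3 (mat z - B)))\<^sup>2"
    using res[of z] d chi[of z] by (simp add: res_norm_adj3 X_def)
  have eA: "X^3 - (frob_norm (adj3 (mat z - A)))\<^sup>2 * X\<^sup>2 + ?D * (frob_norm (mat z - A))\<^sup>2 * X - ?D\<^sup>2 = 0"
    using spec_norm_root[of "adj3 (mat z - A)"]
    by (simp add: X_def[symmetric] adj3_adj3 frob_norm_scale_square det_adj3 norm_power)
  have eB: "X^3 - (frob_norm (adj3 (mat z - B)))\<^sup>2 * X\<^sup>2 + ?D * (frob_norm (mat z - B))\<^sup>2 * X - ?D\<^sup>2 = 0"
    using spec_norm_root[of "adj3 (mat z - B)"]
    by (simp add: XB[symmetric] adj3_adj3 frob_norm_scale_square det_adj3 norm_power chi[symmetric])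
  have "((frob_norm (adj3 (mat z - A)))\<^sup>2 - (frob_norm (adj3 (mat z - B)))\<^sup>2) * X * X
      = ?D * ((frob_norm (mat z - A))\<^sup>2 - (frob_norm (mat z - B))\<^sup>2) * X"
    using eA eB by (simp add: algebra_simps power2_eq_square)
  then show "(frob_diff A B * (cmod z)\<^sup>2 + 2 * Re (z * cross_diff A B) + adj_frob_diff A B) * X = frob_diff A B * ?D"
    unfolding frob_shift_diff frob_adj3_diff using X0 by simp
qed

text \<open>After division by \<open>frob_diff A B\<close>, the resolvent equation makes the squared
  least singular value a quadratic in \<open>z\<close>, which the eigenvalue bound forces to be
  \<open>(cmod (z - a))^2\<close>.\<close>

lemma scalar_if_frob_norm_differs:
  assumes "frob_diff A B \<noteq> 0" "det (mat a - A) = 0"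
  shows "A = mat a"
proof -
  define g where "g z = (cmod z)\<^sup>2
    + 2 * Re (z * (cross_diff A B / of_real (frob_diff A B))) + adj_frob_diff A B / frob_diff A B" for z
  have g: "frob_diff A B * (cmod z)\<^sup>2 + 2 * Re (z * cross_diff A B) + adj_frob_diff A B
      = frob_diff A B * g z" for z
    using assms(1) by (simp add: g_def field_simps)
  have gX: "g z * (spec_norm (adj3 (mat z - A)))\<^sup>2 = (cmod (det (mat z - A)))\<^sup>2"
    if "det (mat z - A) \<noteq> 0" for z
    using resolvent_norm_equation(2)[OF that] assms(1) unfolding g by simp
  have cont: "continuous_on UNIV g" unfolding g_def by (intro continuous_intros)
  have nonneg: "0 \<le> g z" for z
  proof (rule le_off_finite[where f = "\<lambda>_. 0", OF _ cont finite_det_mat_minus[of A]])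
    fix z assume "z \<notin> {z. det (mat z - A) = 0}"
    then have "det (mat z - A) \<noteq> 0" by simp
    then show "0 \<le> g z" using gX[of z] resolvent_norm_equation(1)[of z] by (metis zero_le_mult_iff zero_le_power2 not_less)
  qed simp
  \<comment> \<open>Stated for every eigenvalue, since comparing two of them gives uniqueness
    below.\<close>
  have le: "g z \<le> (cmod (z - a))\<^sup>2" if "det (mat a - A) = 0" for a z
  proof (rule le_off_finite[OF cont _ finite_det_mat_minus[of A]])
    fix z assume "z \<notin> {z. det (mat z - A) = 0}"
    then have d: "det (mat z - A) \<noteq> 0" by simp
    have "g z * (spec_norm (adj3 (mat z - A)))\<^sup>2 \<le> (cmod (z - a) * spec_norm (adj3 (mat z - A)))\<^sup>2"
      unfolding gX[OF d] by (intro power_mono det_le_spec_norm_adj3 that) simp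
    then show "g z \<le> (cmod (z - a))\<^sup>2" using resolvent_norm_equation(1)[OF d] by (simp add: power_mult_distrib)
  qed (intro continuous_intros)
  have sq: "cross_diff A B / of_real (frob_diff A B) = - cnj a
      \<and> adj_frob_diff A B / frob_diff A B = (cmod a)\<^sup>2" if "det (mat a - A) = 0" for a
    using squeeze_norm_square[of "cross_diff A B / of_real (frob_diff A B)"
        "adj_frob_diff A B / frob_diff A B" a] nonneg le[OF that]
    unfolding g_def by blast
  \<comment> \<open>The linear coefficient of \<open>g\<close> equals \<open>- cnj a\<close> for
    each eigenvalue \<open>a\<close>, so there is only one.\<close>
  then have uniq: "a' = a" if "det (mat a' - A) = 0" for a'
    using sq[OF that] sq[OF assms(2)] by (metis complex_cnj_cnj minus_minus)
  obtain a1 a2 a3 where f: "\<And>z. det (mat z - A) = (z - a1) * (z - a2) * (z - a3)"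
    using det_mat_minus_factor by blast
  have "a1 = a" "a2 = a" "a3 = a" by (rule uniq, simp add: f)+
  with f have d: "det (mat z - A) = (z - a)^3" for z by (simp add: power3_eq_cube)
  have ga: "g z = (cmod (z - a))\<^sup>2" for z
    unfolding g_def using sq[OF assms(2)]
    by (simp only: cmod_power2) (simp add: power2_eq_square algebra_simps)
  show ?thesis
  proof (rule mat_eq_of_adj3_bound[OF d])
    fix z assume "z \<noteq> a"
    \<comment> \<open>With a triple eigenvalue, \<open>gX\<close> determines the norm of the
      adjugate as exactly \<open>(cmod (z - a))^2\<close>.\<close>
    have "(cmod ((z - a)^3))\<^sup>2 = (cmod (z - a))\<^sup>2 * ((cmod (z - a))\<^sup>2)\<^sup>2"
      by (simp add: norm_power flip: power_mult power_add)
    moreover have "det (mat z - A) \<noteq> 0" using \<open>z \<noteq> a\<close> by (simp add: d)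
    ultimately have "(cmod (z - a))\<^sup>2 * (spec_norm (adj3 (mat z - A)))\<^sup>2 = (cmod (z - a))\<^sup>2 * ((cmod (z - a))\<^sup>2)\<^sup>2"
      using gX[of z] unfolding ga d by argo
    then have "(spec_norm (adj3 (mat z - A)))\<^sup>2 = ((cmod (z - a))\<^sup>2)\<^sup>2" using \<open>z \<noteq> a\<close> by (simp only: mult_cancel_left) simp
    then show "spec_norm (adj3 (mat z - A)) \<le> (cmod (z - a))\<^sup>2"
      using power2_eq_imp_eq[OF _ spec_norm_nonneg] by fastforce
  qed
qed

end

end

lemma eigenvalue_exists: "\<exists>a. det (mat a - T :: cmat3) = 0"
  using det_mat_minus_factor[of T] by (metis diff_self mult_zero_left)

lemma poly_isometric_of_res_norm_same_char:
  assumes res: "\<And>z. res_norm A z = res_norm B z"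
    and chi: "\<And>z. det (mat z - A) = det (mat z - B)"
  shows "spec_norm (poly_mat p A) = spec_norm (poly_mat p B)"
proof -
  note coeffs = char_coeffs[OF chi]
  obtain a where a: "det (mat a - A) = 0" using eigenvalue_exists by blast
  \<comment> \<open>Otherwise both matrices are the same scalar matrix, whose Frobenius norm cannot
    differ from itself.\<close>
  have d0: "frob_diff A B = 0"
  proof (rule ccontr)
    assume "frob_diff A B \<noteq> 0"
    moreover from this have "frob_diff B A \<noteq> 0" by (simp add: frob_diff_def)
    ultimately have "A = mat a" "B = mat a"
      using scalar_if_frob_norm_differs[of A B a] scalar_if_frob_norm_differs[of B A a] res chi a by metis+
    with \<open>frob_diff A B \<noteq> 0\<close> show False by (simp add: frob_diff_def)
  qed
  define f where "f z = 2 * Re (z * cross_diff A B) + adj_frob_diff A B" for z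
  have cont: "continuous_on UNIV f" unfolding f_def by (intro continuous_intros)
  have f0: "f z = 0" if "z \<notin> {z. det (mat z - A) = 0}" for z
    using resolvent_norm_equation[OF chi res, of z] that d0 by (simp add: f_def)
  have f: "f z = 0" for z
  proof (rule antisym)
    show "f z \<le> 0"
      by (rule le_off_finite[OF cont _ finite_det_mat_minus[of A]]) (use f0 in auto)
    show "0 \<le> f z"
      by (rule le_off_finite[OF _ cont finite_det_mat_minus[of A]]) (use f0 in auto)
  qed
  have k: "adj_frob_diff A B = 0" using f[of 0] by (simp add: f_def)
  \<comment> \<open>Evaluating at the conjugate of \<open>cross_diff A B\<close> isolates its
    modulus.\<close>
  have "2 * (cmod (cross_diff A B))\<^sup>2 = f (cnj (cross_diff A B))"
    unfolding f_def cmod_power2 k by (simp add: power2_eq_square)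
  then have h: "cross_diff A B = 0" by (simp add: f)
  have "cip A A = cip B B" using d0 by (simp add: frob_diff_def cip_self)
  then have "cip (A - mat (trace A)) (A - mat (trace A)) = cip (B - mat (trace B)) (B - mat (trace B))"
    by (simp add: cip_simps coeffs)
  moreover have "cip (adj3 A) (adj3 A) = cip (adj3 B) (adj3 B)"
    using k by (simp add: adj_frob_diff_def cip_self)
  ultimately show ?thesis using coeffs h
    by (intro poly_isometric_of_gram) (auto simp: cross_diff_def)
qed

lemma poly_isometric_of_res_norm:
  assumes res: "\<And>z. res_norm A z = res_norm B z"
  shows "spec_norm (poly_mat p A) = spec_norm (poly_mat p B)"
proof -
  obtain a1 a2 a3 where a: "\<And>z. det (mat z - A) = (z - a1) * (z - a2) * (z - a3)"
    using det_mat_minus_factor by blast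
  obtain b1 b2 b3 where b: "\<And>z. det (mat z - B) = (z - b1) * (z - b2) * (z - b3)"
    using det_mat_minus_factor by blast
  \<comment> \<open>The infinite values of \<open>res_norm\<close> reveal the spectrum, though not
    the multiplicities.\<close>
  have "det (mat z - A) = 0 \<longleftrightarrow> det (mat z - B) = 0" for z
    using res res_norm_infinite_iff by metis
  then have "{a1, a2, a3} = {b1, b2, b3}" by (auto simp: a b)
  from same_roots_cubic[OF this] show ?thesis
  proof (elim disjE exE conjE)
    assume "\<forall>z. (z - a1) * (z - a2) * (z - a3) = (z - b1) * (z - b2) * (z - b3)"
    then show ?thesis by (intro poly_isometric_of_res_norm_same_char res) (simp add: a b)
  next
    fix x y assume "x \<noteq> y" "\<forall>z. (z - a1) * (z - a2) * (z - a3) = (z - x)\<^sup>2 * (z - y)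
       \<and> (z - b1) * (z - b2) * (z - b3) = (z - y)\<^sup>2 * (z - x)"
    then show ?thesis
      by (intro poly_isometric_of_res_norm_distinct_char[OF res, of x y]) (simp_all add: a b)
  qed
qed

section \<open>Quadratic minimal polynomials\<close>

lemma poly_charpoly: "poly (charpoly T) z = det (mat z - T)"
  by (simp add: charpoly_def det_3 mat_def algebra_simps)

lemma poly_mat_eigenvector:
  assumes "T *v v = c *s v"
  shows "poly_mat p T *v v = poly p c *s v"
proof (induction p)
  case 0
  show ?case by (simp add: poly_mat_0)
next
  case (pCons a p)
  have "T *v (poly p c *s v) = poly p c *s (c *s v)"
    using assms by (simp add: vector_scalar_commute)
  then have "poly_mat (pCons a p) T *v v = a *s v + poly p c *s (c *s v)"
    by (simp add: poly_mat_pCons matrix_vector_mult_add_rdistrib mat_mult_vec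
        matrix_vector_mul_assoc[symmetric] pCons.IH)
  then show ?case by (simp add: vec_eq_iff algebra_simps)
qed

text \<open>For \<open>E = A - mat \<gamma>\<close> the quadratic relation leaves
  \<open>t = \<tau>\<close>, which is the rank one case, or \<open>t = 2 * \<tau>\<close>, which the
  maximal multiplicity of \<gamma> excludes.\<close>

lemma min_poly_degree_2_rank1:
  assumes m: "is_min_poly A m" "degree m = 2" and \<gamma>: "max_mult_eig A \<gamma>"
  shows "\<exists>\<delta>. m = [:-\<gamma>, 1:] * [:-\<delta>, 1:] \<and> adj3 (A - mat \<gamma>) = 0 \<and> trace (A - mat \<gamma>) = \<delta> - \<gamma>"
proof -
  define E where "E = A - mat \<gamma>"
  have "det (mat \<gamma> - A) = 0" using \<gamma> by (simp add: max_mult_eig_def poly_charpoly)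
  then obtain v where v: "v \<noteq> 0" "(mat \<gamma> - A) *v v = 0" unfolding det_eq_0_iff_kernel by blast
  then have Av: "A *v v = \<gamma> *s v" by (simp add: matrix_vector_mult_diff_rdistrib mat_mult_vec)
  then have "E *v v = 0" by (simp add: E_def matrix_vector_mult_diff_rdistrib mat_mult_vec)
  then have dE: "det E = 0" using v det_eq_0_iff_kernel by blast
  have "poly m \<gamma> *s v = 0"
    using poly_mat_eigenvector[OF Av, of m] m(1) by (simp add: is_min_poly_def)
  then have "poly m \<gamma> = 0" using v by simp
  then obtain n where n: "m = [:-\<gamma>, 1:] * n" by (metis dvdE poly_eq_0_iff_dvd)
  have "n \<noteq> 0" using n m by auto
  then have "degree ([:-\<gamma>, 1:] * n) = 1 + degree n" by (subst degree_mult_eq) auto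
  then have "degree n = 1" using n m(2) by simp
  moreover have "lead_coeff n = 1" using m(1) unfolding is_min_poly_def n lead_coeff_mult by simp
  ultimately have "n = [:coeff n 0, 1:]"
    by (intro poly_eqI) (auto simp: coeff_pCons coeff_eq_0 split: nat.splits)
  then obtain \<delta> where "n = [:-\<delta>, 1:]" by (metis minus_minus)
  with n have mf: "m = [:-\<gamma>, 1:] * [:-\<delta>, 1:]" by simp
  define \<tau> where "\<tau> = \<delta> - \<gamma>"
  define t where "t = trace E"
  define s where "s = e2 E"
  have lin: "poly_mat [:-c, 1:] A = A - mat c" for c
    by (simp add: poly_mat_pCons poly_mat_0 mat3_simps)
  have "(A - mat \<gamma>) ** (A - mat \<delta>) = 0"
    using m(1) by (simp only: is_min_poly_def mf poly_mat_mult lin)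
  moreover have "A - mat \<delta> = E - mat \<tau>" by (simp add: E_def \<tau>_def mat3_simps)
  moreover have "E ** (E - mat \<tau>) = E ** E - mat \<tau> ** E" by (simp add: mat3_simps algebra_simps)
  ultimately have EE: "E ** E = mat \<tau> ** E" by (simp add: E_def)
  \<comment> \<open>Otherwise a linear polynomial would annihilate \<open>A\<close>.\<close>
  have E0: "E \<noteq> 0"
  proof
    assume "E = 0"
    then have "poly_mat [:-\<gamma>, 1:] A = 0" unfolding lin by (simp add: E_def)
    moreover have "[:-\<gamma>, 1:] \<noteq> 0" by simp
    ultimately have "degree m \<le> degree [:-\<gamma>, 1:]" using m(1) unfolding is_min_poly_def by blast
    with m(2) show False by simp
  qed
  have aE: "adj3 E = mat (\<tau> - t) ** E + mat s"
    unfolding adj3_def EE t_def[symmetric] s_def[symmetric] by (simp add: mat3_simps algebra_simps)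
  \<comment> \<open>Taking traces in \<open>aE\<close> gives the first relation between
    \<open>s\<close> and \<open>t\<close>; multiplying it by \<open>E\<close>, with
    \<open>det E = 0\<close>, gives the second.\<close>
  have "s = (\<tau> - t) * t + 3 * s"
    using arg_cong[OF aE, of trace] by (simp add: trace_adj3 trace_add trace_scale trace_mat s_def t_def)
  then have s1: "2 * s = (t - \<tau>) * t" by (simp add: algebra_simps)
  have "mat ((\<tau> - t) * \<tau> + s) ** E = mat (\<tau> - t) ** (mat \<tau> ** E) + mat s ** E"
    by (simp add: mat3_simps algebra_simps)
  also have "\<dots> = E ** (mat (\<tau> - t) ** E + mat s)"
    unfolding EE[symmetric] by (simp add: mat3_simps algebra_simps)
  also have "\<dots> = 0" unfolding aE[symmetric] mult_adj3 dE by simp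
  finally have "mat ((\<tau> - t) * \<tau> + s) ** E = 0" .
  then have "cmod ((\<tau> - t) * \<tau> + s) * spec_norm E = 0"
    by (metis spec_norm_scale spec_norm_eq_0_iff)
  then have "(\<tau> - t) * \<tau> + s = 0" using E0 by (simp add: spec_norm_eq_0_iff)
  then have s2: "s = (t - \<tau>) * \<tau>" by (simp add: algebra_simps eq_neg_iff_add_eq_0)
  have "(t - \<tau>) * (t - 2 * \<tau>) = 0" using s1 unfolding s2 by (simp add: algebra_simps)
  \<comment> \<open>If \<open>\<tau> = 0\<close>, the second root coincides with the first.\<close>
  then have "t = \<tau> \<or> t = 2 * \<tau> \<and> \<tau> \<noteq> 0" by auto
  then show ?thesis
  proof (elim disjE conjE)
    assume "t = \<tau>"
    with s2 aE have "adj3 E = 0" by simp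
    with \<open>t = \<tau>\<close> mf show ?thesis by (auto simp: E_def t_def \<tau>_def)
  next
    assume t: "t = 2 * \<tau>" and \<tau>: "\<tau> \<noteq> 0"
    \<comment> \<open>Here \<gamma> would be simple and \<delta> double.\<close>
    have "det (mat z - A) = (z - \<gamma>) * (z - \<delta>)\<^sup>2" for z
    proof -
      have "mat z - A = mat (z - \<gamma>) - E" by (simp add: E_def mat3_simps)
      then have "det (mat z - A) = (z - \<gamma>)^3 - t * (z - \<gamma>)\<^sup>2 + s * (z - \<gamma>)"
        by (simp only: det_mat_minus dE t_def s_def) simp
      also have "\<dots> = (z - \<gamma>) * (z - \<delta>)\<^sup>2"
        unfolding s2 t \<tau>_def by (simp add: power2_eq_square power3_eq_cube algebra_simps)
      finally show ?thesis .
    qed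
    then have "poly (charpoly A) = poly ([:-\<gamma>, 1:] * [:-\<delta>, 1:]^2)"
      by (simp add: fun_eq_iff poly_charpoly algebra_simps)
    then have c: "charpoly A = [:-\<gamma>, 1:] * [:-\<delta>, 1:]^2" by (simp only: poly_eq_poly_eq_iff)
    have "order \<gamma> [:-\<delta>, 1:] = 0" "order \<delta> [:-\<gamma>, 1:] = 0"
      using \<tau> by (auto intro!: order_0I simp: \<tau>_def)
    moreover have "order c [:-c, 1:] = 1" for c :: complex using order_power_n_n[of c 1] by simp
    moreover have nz: "[:-c, 1:] \<noteq> 0" for c :: complex by simp
    ultimately have "order \<gamma> (charpoly A) = 1" "order \<delta> (charpoly A) = 2"
      unfolding c power2_eq_square by (simp_all add: order_mult del: mult_pCons_left mult_pCons_right)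
    then show ?thesis using \<gamma> unfolding max_mult_eig_def by (metis not_less_eq_eq numeral_2_eq_2 One_nat_def order_refl)
  qed
qed

theorem theorem10:
  fixes A B :: cmat3
  shows "((\<forall>z. res_norm A z = res_norm B z) \<longleftrightarrow>
           (\<forall>p. spec_norm (poly_mat p A) = spec_norm (poly_mat p B)))
       \<and> ((\<exists>m. is_min_poly A m \<and> is_min_poly B m \<and> degree m = 2) \<longrightarrow>
           (\<forall>\<gamma>A \<gamma>B. max_mult_eig A \<gamma>A \<and> max_mult_eig B \<gamma>B \<longrightarrow>
              ((\<forall>z. res_norm A z = res_norm B z) \<longleftrightarrow>
               frob_norm (A - mat \<gamma>A) = frob_norm (B - mat \<gamma>B))))"
proof (intro conjI impI allI iffI)
  fix p assume "\<forall>z. res_norm A z = res_norm B z"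
  then show "spec_norm (poly_mat p A) = spec_norm (poly_mat p B)"
    using poly_isometric_of_res_norm by blast
next
  fix z assume iso: "\<forall>p. spec_norm (poly_mat p A) = spec_norm (poly_mat p B)"
  show "res_norm A z = res_norm B z"
  proof (cases "det (mat z - A) = 0 \<and> det (mat z - B) = 0")
    case True
    then show ?thesis by (simp add: res_norm_def)
  next
    case False
    then show ?thesis
      using res_norm_eq_of_poly_isometric[of A B z] res_norm_eq_of_poly_isometric[of B A z] iso by metis
  qed
next
  fix \<gamma>A \<gamma>B
  assume "\<exists>m. is_min_poly A m \<and> is_min_poly B m \<and> degree m = 2"
    and \<gamma>: "max_mult_eig A \<gamma>A \<and> max_mult_eig B \<gamma>B"
  then obtain m where m: "is_min_poly A m" "is_min_poly B m" "degree m = 2" by blast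
  obtain \<delta>A where A: "m = [:-\<gamma>A, 1:] * [:-\<delta>A, 1:]" "adj3 (A - mat \<gamma>A) = 0" "trace (A - mat \<gamma>A) = \<delta>A - \<gamma>A"
    using min_poly_degree_2_rank1 m \<gamma> by blast
  obtain \<delta>B where B: "m = [:-\<gamma>B, 1:] * [:-\<delta>B, 1:]" "adj3 (B - mat \<gamma>B) = 0" "trace (B - mat \<gamma>B) = \<delta>B - \<gamma>B"
    using min_poly_degree_2_rank1 m \<gamma> by blast
  have pq: "\<gamma>A * \<delta>A = \<gamma>B * \<delta>B" "\<gamma>A + \<delta>A = \<gamma>B + \<delta>B"
    using A(1) B(1) by (auto simp: algebra_simps)
  \<comment> \<open>\<open>\<gamma>B\<close> is a root of the common minimal polynomial, so the two
    factorizations agree up to order.\<close>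
  have "(\<gamma>B - \<gamma>A) * (\<gamma>B - \<delta>A) = \<gamma>B * \<gamma>B - (\<gamma>A + \<delta>A) * \<gamma>B + \<gamma>A * \<delta>A"
    by (simp add: algebra_simps)
  also have "\<dots> = 0" unfolding pq by (simp add: algebra_simps)
  finally have "\<gamma>B = \<gamma>A \<or> \<gamma>B = \<delta>A" by simp
  then have same: "\<gamma>B = \<gamma>A \<and> \<delta>B = \<delta>A \<or> \<gamma>B = \<delta>A \<and> \<delta>B = \<gamma>A"
    using pq(2) by auto
  note iff = res_norm_rank1_eq_iff[OF A(2,3) B(2,3) same]
  show "frob_norm (A - mat \<gamma>A) = frob_norm (B - mat \<gamma>B)" if "\<forall>z. res_norm A z = res_norm B z"
    using iff that by blast
  show "res_norm A z = res_norm B z" if "frob_norm (A - mat \<gamma>A) = frob_norm (B - mat \<gamma>B)" for z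
    using iff that by blast
qed

end
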